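(* Let $E$ be a normed space, $F$ a (normed) $PL$-space, and let $E\otimes_pF$ be the projective tensor product of $E$ and the underlying normed space of $F$, regarded as a $PL$-space (see context). Then there exists an $L$-isometric isomorphism $I:E_{\max}\otimes_{pl}F\to E\otimes_pF$, acting as the identity operator on the common underlying linear space $E\otimes F$. As a corollary, there exists an $L$-isometric isomorphism $\widehat I:E_{\max}\widehat\otimes_{pl}F\to E\widehat\otimes_pF$ which is the extension by continuity of $I$.
   Context: All linear spaces are complex. $H$ is a fixed separable infinite-dimensional Hilbert space, $\mathcal{B}$ is the algebra of bounded operators on $H$ with the operator norm. For a linear space $E$, $HE:=H\otimes E$ (algebraic tensor product), with elementary tensors written $\xi x$; it is a left $\mathcal{B}$-module via $a\cdot(\xi x):=a(\xi)x$. A (normed) $PL$-space is a linear space $E$ together with a norm on $HE$ (the $PL$-norm) such that $\|a\cdot u\|\le\|a\|\|u\|$ for all $a\in\mathcal{B}$, $u\in HE$. Its underlying normed space is $E$ with $\|x\|:=\|\xi x\|$ for any $\xi\in H$, $\|\xi\|=1$ (independent of $\xi$). A $PL$-space is complete if its underlying normed space is complete. A linear operator $\varphi:E\to F$ has amplification $\varphi_\infty:HE\to HF,\ \xi x\mapsto\xi\varphi(x)$; between $PL$-spaces, $\varphi$ is $L$-isometric (resp. an $L$-isometric isomorphism) if $\varphi_\infty$ is isometric (resp. an isometric isomorphism). The completion of a $PL$-space $E$ is the complete $PL$-space $\overline{E}$ (the usual completion of the underlying normed space), where the norm on $H\overline{E}$ is induced by the natural embedding of $H\overline{E}$ into the completion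 $\overline{HE}$ of the normed space $HE$, $\xi x\mapsto\lim\xi x_n$ for $x_n\in E$, $x_n\to x$. $\otimes_p$ is the non-completed projective tensor product of normed spaces. For a normed space $E$, $E_{\max}$ is the $PL$-space $E$ with the norm on $HE$ equal to that of $H\otimes_pE$. For a normed space $E$ and a $PL$-space $F$, the $PL$-space $E\otimes_pF$ is $E\otimes F$ with the norm on $H(E\otimes F)$ for which the linear isomorphism $H(E\otimes F)\to E\otimes_p(HF)$, $\xi(x\otimes y)\mapsto x\otimes\xi y$, is isometric; its underlying normed space is the usual $E\otimes_pF$. $E\widehat\otimes_pF$ is the completion of this $PL$-space. Fix a unitary isomorphism $\iota$ from the Hilbert tensor product $H\widehat\otimes_{hil}H$ onto $H$, and put $\xi\diamondsuit\eta:=\iota(\xi\otimes\eta)$. For $u\in HE$, $v\in HF$ the element $u\diamondsuit v\in H(E\otimes F)$ is well defined bilinearly by $\xi x\diamondsuit\eta y:=(\xi\diamondsuit\eta)(x\otimes y)$. For $PL$-spaces $E,F$, $E\otimes_{pl}F$ is the $PL$-space $E\otimes F$ with the norm on $H(E\otimes F)$ $$\|U\|_{pl}:=\inf\Big\{\sum_{k=1}^n\|a_k\|\|u_k\|\|v_k\|\Big\},$$ the infimum being over all representations $U=\sum_{k=1}^n a_k\cdot(u_k\diamondsuit v_k)$ with $a_k\in\mathcal{B}$, $u_k\in HE$, $v_k\in HF$. $E\widehat\otimes_{pl}F$ is the completion of the $PL$-space $E\otimes_{pl}F$. *)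

theory Defs
  imports "HOL-Analysis.Analysis" "HOL-Library.Poly_Mapping"
begin

section \<open>Complex vector spaces, normed spaces, Hilbert spaces\<close>

class scaleC = scaleR +
  fixes scaleC :: "complex \<Rightarrow> 'a \<Rightarrow> 'a" (infixr \<open>*\<^sub>C\<close> 75)
  assumes scaleR_scaleC: "scaleR r x = complex_of_real r *\<^sub>C x"

class complex_vector = scaleC + ab_group_add +
  assumes scaleC_add_right: "a *\<^sub>C (x + y) = a *\<^sub>C x + a *\<^sub>C y"
    and scaleC_add_left: "(a + b) *\<^sub>C x = a *\<^sub>C x + b *\<^sub>C x"
    and scaleC_scaleC: "a *\<^sub>C b *\<^sub>C x = (a * b) *\<^sub>C x"
    and scaleC_one: "1 *\<^sub>C x = x"

subclass (in complex_vector) real_vector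
  by standard
    (simp_all add: scaleR_scaleC scaleC_add_right scaleC_add_left scaleC_scaleC scaleC_one)

global_interpretation complex_vector:
  vector_space "scaleC :: complex \<Rightarrow> 'a \<Rightarrow> 'a::complex_vector"
  defines cspan = complex_vector.span
  by standard (simp_all add: scaleC_add_right scaleC_add_left scaleC_scaleC scaleC_one)

abbreviation clinear :: "('a::complex_vector \<Rightarrow> 'b::complex_vector) \<Rightarrow> bool"
  where "clinear \<equiv> Vector_Spaces.linear scaleC scaleC"

lemma clinear_iff:
  "clinear f \<longleftrightarrow> (\<forall>x y. f (x + y) = f x + f y) \<and> (\<forall>c x. f (c *\<^sub>C x) = c *\<^sub>C f x)"
  by (simp add: Vector_Spaces.linear_iff complex_vector.vector_space_axioms)

lemma clinear_zero: "clinear f \<Longrightarrow> f 0 = 0"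
  unfolding clinear_iff by (metis add_cancel_right_right)

definition cbilinear :: "('a::complex_vector \<Rightarrow> 'b::complex_vector \<Rightarrow> 'c::complex_vector) \<Rightarrow> bool"
  where "cbilinear f \<longleftrightarrow> (\<forall>y. clinear (\<lambda>x. f x y)) \<and> (\<forall>x. clinear (f x))"

class complex_normed_vector = complex_vector + real_normed_vector +
  assumes norm_scaleC: "norm (c *\<^sub>C x) = cmod c * norm x"

text \<open>The inner product is conjugate-linear in the first argument. Nonnegativity and
  definiteness of \<^term>\<open>cinner x x\<close> are contained in the last axiom.\<close>

class complex_inner = complex_normed_vector +
  fixes cinner :: "'a \<Rightarrow> 'a \<Rightarrow> complex"
  assumes cinner_commute: "cinner x y = cnj (cinner y x)"
    and cinner_add_right: "cinner x (y + z) = cinner x y + cinner x z"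
    and cinner_scaleC_right: "cinner x (c *\<^sub>C y) = c * cinner x y"
    and cinner_self: "cinner x x = complex_of_real ((norm x)\<^sup>2)"

class chilbert_space = complex_inner + complete_space

definition bounded_clinear :: "('a::complex_normed_vector \<Rightarrow> 'b::complex_normed_vector) \<Rightarrow> bool"
  where "bounded_clinear a \<longleftrightarrow> clinear a \<and> bounded_linear a"

definition unitary :: "('a::complex_inner \<Rightarrow> 'b::complex_inner) \<Rightarrow> bool"
  where "unitary f \<longleftrightarrow> clinear f \<and> bij f \<and> (\<forall>x y. cinner (f x) (f y) = cinner x y)"

text \<open>\<^term>\<open>t :: 'h::chilbert_space \<Rightarrow> 'h \<Rightarrow> 'k::chilbert_space\<close> exhibits \<open>'k\<close> as the Hilbert tensor
  product of \<open>'h\<close> with itself, i.e. as the Hilbert space completion of the algebraic tensor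
  product with respect to the product inner product.\<close>

definition hilbert_tensor_product :: "('h::chilbert_space \<Rightarrow> 'h \<Rightarrow> 'k::chilbert_space) \<Rightarrow> bool"
  where "hilbert_tensor_product t \<longleftrightarrow> cbilinear t
    \<and> (\<forall>\<xi> \<eta> \<xi>' \<eta>'. cinner (t \<xi> \<eta>) (t \<xi>' \<eta>') = cinner \<xi> \<xi>' * cinner \<eta> \<eta>')
    \<and> closure (cspan {t \<xi> \<eta> |\<xi> \<eta>. True}) = UNIV"


section \<open>The algebraic tensor product of complex vector spaces\<close>

definition free_scale :: "complex \<Rightarrow> ('k \<Rightarrow>\<^sub>0 complex) \<Rightarrow> ('k \<Rightarrow>\<^sub>0 complex)"
  where "free_scale c u = Poly_Mapping.map ((*) c) u"

lemma lookup_free_scale: "Poly_Mapping.lookup (free_scale c u) k = c * Poly_Mapping.lookup u k"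
  unfolding free_scale_def by (simp add: Poly_Mapping.map.rep_eq when_def)

lemma free_scale_add: "free_scale c (u + v) = free_scale c u + free_scale c v"
  and free_scale_diff: "free_scale c (u - v) = free_scale c u - free_scale c v"
  and free_scale_add_left: "free_scale (c + d) u = free_scale c u + free_scale d u"
  and free_scale_free_scale: "free_scale c (free_scale d u) = free_scale (c * d) u"
  and free_scale_one: "free_scale 1 u = u"
  and free_scale_zero: "free_scale c 0 = 0"
  and free_scale_minus_one: "free_scale (- 1) u = - u"
  and free_scale_single: "free_scale c (Poly_Mapping.single k d) = Poly_Mapping.single k (c * d)"
  by (rule poly_mapping_eqI;
      simp add: lookup_free_scale lookup_add lookup_minus lookup_single algebra_simps when_def)+

text \<open>The subspace of the free vector space on pairs that is spanned by the bilinearity relations.\<close>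

inductive_set tensor_relations :: "(('a::complex_vector \<times> 'b::complex_vector) \<Rightarrow>\<^sub>0 complex) set" where
  zero: "0 \<in> tensor_relations"
| add: "u \<in> tensor_relations \<Longrightarrow> v \<in> tensor_relations \<Longrightarrow> u + v \<in> tensor_relations"
| add_left: "Poly_Mapping.single (x + x', y) c - Poly_Mapping.single (x, y) c
    - Poly_Mapping.single (x', y) c \<in> tensor_relations"
| add_right: "Poly_Mapping.single (x, y + y') c - Poly_Mapping.single (x, y) c
    - Poly_Mapping.single (x, y') c \<in> tensor_relations"
| scale_left: "Poly_Mapping.single (d *\<^sub>C x, y) c - Poly_Mapping.single (x, y) (c * d) \<in> tensor_relations"
| scale_right: "Poly_Mapping.single (x, d *\<^sub>C y) c - Poly_Mapping.single (x, y) (c * d) \<in> tensor_relations"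

lemma tensor_relations_scale:
  "u \<in> tensor_relations \<Longrightarrow> free_scale c u \<in> tensor_relations"
proof (induction rule: tensor_relations.induct)
  case zero then show ?case by (simp add: free_scale_zero tensor_relations.zero)
next
  case (add u v) then show ?case by (simp add: free_scale_add tensor_relations.add)
next
  case (add_left x x' y d)
  then show ?case
    by (simp add: free_scale_diff free_scale_single tensor_relations.add_left)
next
  case (add_right x y y' d)
  then show ?case
    by (simp add: free_scale_diff free_scale_single tensor_relations.add_right)
next
  case (scale_left e x y d)
  then show ?case
    by (simp add: free_scale_diff free_scale_single mult.assoc[symmetric] tensor_relations.scale_left)
next
  case (scale_right x e y d)
  then show ?case
    by (simp add: free_scale_diff free_scale_single mult.assoc[symmetric] tensor_relations.scale_right)
qed

lemma tensor_relations_uminus: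
  "u \<in> tensor_relations \<Longrightarrow> - u \<in> tensor_relations"
  using tensor_relations_scale[of u "- 1"] by (simp add: free_scale_minus_one)

definition tensor_equiv :: "(('a::complex_vector \<times> 'b::complex_vector) \<Rightarrow>\<^sub>0 complex)
    \<Rightarrow> (('a \<times> 'b) \<Rightarrow>\<^sub>0 complex) \<Rightarrow> bool"
  where "tensor_equiv u v \<longleftrightarrow> u - v \<in> tensor_relations"

lemma equivp_tensor_equiv:
  "equivp (tensor_equiv :: (('a::complex_vector \<times> 'b::complex_vector) \<Rightarrow>\<^sub>0 complex) \<Rightarrow> _)"
proof (rule equivpI)
  show "reflp (tensor_equiv :: (('a \<times> 'b) \<Rightarrow>\<^sub>0 complex) \<Rightarrow> _)"
    by (simp add: reflp_def tensor_equiv_def tensor_relations.zero)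
  show "symp (tensor_equiv :: (('a \<times> 'b) \<Rightarrow>\<^sub>0 complex) \<Rightarrow> _)"
  proof (rule sympI)
    fix u v :: "('a \<times> 'b) \<Rightarrow>\<^sub>0 complex"
    assume "tensor_equiv u v"
    then show "tensor_equiv v u"
      using tensor_relations_uminus[of "u - v"] by (simp add: tensor_equiv_def)
  qed
  show "transp (tensor_equiv :: (('a \<times> 'b) \<Rightarrow>\<^sub>0 complex) \<Rightarrow> _)"
  proof (rule transpI)
    fix u v w :: "('a \<times> 'b) \<Rightarrow>\<^sub>0 complex"
    assume "tensor_equiv u v" "tensor_equiv v w"
    then show "tensor_equiv u w"
      using tensor_relations.add[of "u - v" "v - w"] by (simp add: tensor_equiv_def)
  qed
qed

quotient_type (overloaded) ('a, 'b) ctensor =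
  "('a::complex_vector \<times> 'b::complex_vector) \<Rightarrow>\<^sub>0 complex" / tensor_equiv
  by (rule equivp_tensor_equiv)

instantiation ctensor :: (complex_vector, complex_vector) complex_vector
begin

lift_definition zero_ctensor :: "('a, 'b) ctensor" is 0 .

lift_definition plus_ctensor :: "('a, 'b) ctensor \<Rightarrow> ('a, 'b) ctensor \<Rightarrow> ('a, 'b) ctensor"
  is "\<lambda>u v. u + v"
  unfolding tensor_equiv_def by (metis add_diff_add tensor_relations.add)

lift_definition uminus_ctensor :: "('a, 'b) ctensor \<Rightarrow> ('a, 'b) ctensor" is "\<lambda>u. - u"
  unfolding tensor_equiv_def by (metis minus_diff_minus tensor_relations_uminus)

lift_definition minus_ctensor :: "('a, 'b) ctensor \<Rightarrow> ('a, 'b) ctensor \<Rightarrow> ('a, 'b) ctensor"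
  is "\<lambda>u v. u - v"
proof -
  fix u u' v v' :: "('a \<times> 'b) \<Rightarrow>\<^sub>0 complex"
  assume "tensor_equiv u u'" "tensor_equiv v v'"
  then have "(u - u') + - (v - v') \<in> tensor_relations"
    unfolding tensor_equiv_def by (intro tensor_relations.add tensor_relations_uminus)
  moreover have "(u - u') + - (v - v') = u - v - (u' - v')" by simp
  ultimately show "tensor_equiv (u - v) (u' - v')" by (simp only: tensor_equiv_def)
qed

lift_definition scaleC_ctensor :: "complex \<Rightarrow> ('a, 'b) ctensor \<Rightarrow> ('a, 'b) ctensor" is free_scale
  unfolding tensor_equiv_def by (metis free_scale_diff tensor_relations_scale)

definition scaleR_ctensor :: "real \<Rightarrow> ('a, 'b) ctensor \<Rightarrow> ('a, 'b) ctensor"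
  where "scaleR_ctensor r u = complex_of_real r *\<^sub>C u"

instance
proof
  fix a b c :: "('a, 'b) ctensor" and d e :: complex and r :: real
  show "r *\<^sub>R a = complex_of_real r *\<^sub>C a" by (rule scaleR_ctensor_def)
  have refl: "tensor_equiv u u" for u :: "('a \<times> 'b) \<Rightarrow>\<^sub>0 complex"
    by (simp add: tensor_equiv_def tensor_relations.zero)
  show "a + b + c = a + (b + c)" by transfer (simp add: add.assoc refl)
  show "a + b = b + a" by transfer (simp add: add.commute refl)
  show "0 + a = a" by transfer (simp add: refl)
  show "- a + a = 0" by transfer (simp add: refl)
  show "a - b = a + - b" by transfer (simp add: refl)
  show "d *\<^sub>C (a + b) = d *\<^sub>C a + d *\<^sub>C b" by transfer (simp add: free_scale_add refl)
  show "(d + e) *\<^sub>C a = d *\<^sub>C a + e *\<^sub>C a" by transfer (simp add: free_scale_add_left refl)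
  show "d *\<^sub>C e *\<^sub>C a = (d * e) *\<^sub>C a" by transfer (simp add: free_scale_free_scale refl)
  show "1 *\<^sub>C a = a" by transfer (simp add: free_scale_one refl)
qed

end

lift_definition elem_tensor :: "'a::complex_vector \<Rightarrow> 'b::complex_vector \<Rightarrow> ('a, 'b) ctensor"
    (infixr \<open>\<otimes>\<^sub>C\<close> 75)
  is "\<lambda>x y. Poly_Mapping.single (x, y) 1" .

lemma cbilinear_elem_tensor: "cbilinear (\<otimes>\<^sub>C)"
proof -
  have "(x + x') \<otimes>\<^sub>C y = x \<otimes>\<^sub>C y + x' \<otimes>\<^sub>C y" for x x' :: 'a and y :: 'b
    by transfer (use tensor_relations.add_left[where c = 1] in
        \<open>simp add: tensor_equiv_def diff_diff_add\<close>)
  moreover have "(c *\<^sub>C x) \<otimes>\<^sub>C y = c *\<^sub>C (x \<otimes>\<^sub>C y)" for c and x :: 'a and y :: 'b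
    by transfer (use tensor_relations.scale_left[where c = 1] in
        \<open>simp add: tensor_equiv_def free_scale_single\<close>)
  moreover have "x \<otimes>\<^sub>C (y + y') = x \<otimes>\<^sub>C y + x \<otimes>\<^sub>C y'" for x :: 'a and y y' :: 'b
    by transfer (use tensor_relations.add_right[where c = 1] in
        \<open>simp add: tensor_equiv_def diff_diff_add\<close>)
  moreover have "x \<otimes>\<^sub>C (c *\<^sub>C y) = c *\<^sub>C (x \<otimes>\<^sub>C y)" for c and x :: 'a and y :: 'b
    by transfer (use tensor_relations.scale_right[where c = 1] in
        \<open>simp add: tensor_equiv_def free_scale_single\<close>)
  ultimately show ?thesis
    by (simp add: cbilinear_def clinear_iff)
qed

text \<open>The linear map out of the tensor product induced by a bilinear map; see
  \<open>tensor_lift_unique\<close> and \<open>tensor_lift\<close> for the universal property.\<close>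

definition tensor_lift :: "('a::complex_vector \<Rightarrow> 'b::complex_vector \<Rightarrow> 'c::complex_vector)
    \<Rightarrow> ('a, 'b) ctensor \<Rightarrow> 'c"
  where "tensor_lift f = (THE g. clinear g \<and> (\<forall>x y. g (x \<otimes>\<^sub>C y) = f x y))"

lemma free_induct [case_names zero single add]:
  fixes u :: "'k \<Rightarrow>\<^sub>0 complex"
  assumes "P 0" and "\<And>k c. P (Poly_Mapping.single k c)" and "\<And>u v. P u \<Longrightarrow> P v \<Longrightarrow> P (u + v)"
  shows "P u"
proof (induction u rule: update_induct)
  case const
  then show ?case by (rule assms(1))
next
  case (update f a b)
  have "Poly_Mapping.update a b f = f + Poly_Mapping.single a b"
    using update by (intro poly_mapping_eqI)
      (auto simp: lookup_update lookup_add lookup_single when_def in_keys_iff)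
  moreover have "P (f + Poly_Mapping.single a b)"
    using update.IH assms(2) by (rule assms(3))
  ultimately show ?case by simp
qed

lemma ctensor_induct [case_names zero elem add]:
  fixes t :: "('a::complex_vector, 'b::complex_vector) ctensor"
  assumes "P 0" and "\<And>x y. P (x \<otimes>\<^sub>C y)" and "\<And>u v. P u \<Longrightarrow> P v \<Longrightarrow> P (u + v)"
  shows "P t"
proof -
  have scaled: "P (c *\<^sub>C x \<otimes>\<^sub>C y)" for c x y
  proof -
    have "c *\<^sub>C (x \<otimes>\<^sub>C y) = (c *\<^sub>C x) \<otimes>\<^sub>C y"
      using cbilinear_elem_tensor[where ?'a = 'a and ?'b = 'b]
      by (simp add: cbilinear_def clinear_iff)
    then show ?thesis using assms(2) by simp
  qed
  have "P (abs_ctensor u)" for u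
  proof (induction u rule: free_induct)
    case zero
    then show ?case using assms(1) by (simp add: zero_ctensor.abs_eq)
  next
    case (single k c)
    have "abs_ctensor (Poly_Mapping.single k c) = c *\<^sub>C (fst k \<otimes>\<^sub>C snd k)"
      by (simp add: elem_tensor.abs_eq scaleC_ctensor.abs_eq free_scale_single)
    then show ?case using scaled by simp
  next
    case (add u v)
    then show ?case using assms(3)[OF add] by (simp add: plus_ctensor.abs_eq)
  qed
  then show ?thesis by (metis Quotient3_abs_rep Quotient3_ctensor)
qed

lemma tensor_lift_unique:
  assumes "clinear g" "clinear h" "\<And>x y. g (x \<otimes>\<^sub>C y) = h (x \<otimes>\<^sub>C y)"
  shows "g = h"
proof
  fix t
  interpret g: Vector_Spaces.linear scaleC scaleC g by fact
  interpret h: Vector_Spaces.linear scaleC scaleC h by fact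
  show "g t = h t"
    by (induction t rule: ctensor_induct) (simp_all add: g.zero h.zero g.add h.add assms(3))
qed

definition free_lift :: "('a::complex_vector \<Rightarrow> 'b::complex_vector \<Rightarrow> 'c::complex_vector)
    \<Rightarrow> (('a \<times> 'b) \<Rightarrow>\<^sub>0 complex) \<Rightarrow> 'c"
  where "free_lift f u = (\<Sum>k\<in>Poly_Mapping.keys u. Poly_Mapping.lookup u k *\<^sub>C f (fst k) (snd k))"

lemma free_lift_superset:
  assumes "finite A" "Poly_Mapping.keys u \<subseteq> A"
  shows "free_lift f u = (\<Sum>k\<in>A. Poly_Mapping.lookup u k *\<^sub>C f (fst k) (snd k))"
  unfolding free_lift_def using assms
  by (intro sum.mono_neutral_left) (auto simp: in_keys_iff)

lemma free_lift_add: "free_lift f (u + v) = free_lift f u + free_lift f v"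
proof -
  let ?A = "Poly_Mapping.keys u \<union> Poly_Mapping.keys v"
  have "Poly_Mapping.keys (u + v) \<subseteq> ?A" by (rule Poly_Mapping.keys_add)
  then show ?thesis
    by (simp add: free_lift_superset[of ?A] lookup_add scaleC_add_left sum.distrib)
qed

lemma free_lift_scale: "free_lift f (free_scale c u) = c *\<^sub>C free_lift f u"
proof -
  have "Poly_Mapping.keys (free_scale c u) \<subseteq> Poly_Mapping.keys u" by (auto simp: in_keys_iff lookup_free_scale)
  then show ?thesis
    by (simp add: free_lift_superset[of "Poly_Mapping.keys u"] lookup_free_scale
        complex_vector.scale_sum_right scaleC_scaleC)
qed

lemma free_lift_diff: "free_lift f (u - v) = free_lift f u - free_lift f v"
  using free_lift_add[of f "u - v" v] by (simp add: algebra_simps)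

lemma free_lift_single: "free_lift f (Poly_Mapping.single k c) = c *\<^sub>C f (fst k) (snd k)"
  by (simp add: free_lift_def)

lemma free_lift_relations:
  assumes "cbilinear f" "u \<in> tensor_relations"
  shows "free_lift f u = 0"
  using assms(2)
proof (induction rule: tensor_relations.induct)
  case zero
  then show ?case by (simp add: free_lift_def)
qed (use assms(1) in \<open>auto simp: free_lift_add free_lift_diff free_lift_single cbilinear_def
      clinear_iff scaleC_add_right scaleC_scaleC\<close>)

lemma tensor_lift:
  assumes "cbilinear f"
  shows clinear_tensor_lift: "clinear (tensor_lift f)"
    and tensor_lift_elem: "tensor_lift f (x \<otimes>\<^sub>C y) = f x y"
proof -
  define g where "g t = free_lift f (rep_ctensor t)" for t
  have g_abs: "g (abs_ctensor u) = free_lift f u" for u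
  proof -
    have "tensor_equiv (rep_ctensor (abs_ctensor u)) u"
      using Quotient3_rep_abs[OF Quotient3_ctensor] equivp_tensor_equiv equivp_reflp by metis
    then show ?thesis
      using free_lift_relations[OF assms, of "rep_ctensor (abs_ctensor u) - u"]
      by (simp add: g_def tensor_equiv_def free_lift_diff)
  qed
  have ex_abs: "\<exists>u. t = abs_ctensor u" for t :: "('a, 'b) ctensor"
    by (metis Quotient3_abs_rep Quotient3_ctensor)
  have "g (s + t) = g s + g t" for s t
    using ex_abs[of s] ex_abs[of t] by (auto simp: plus_ctensor.abs_eq g_abs free_lift_add)
  moreover have "g (c *\<^sub>C t) = c *\<^sub>C g t" for c t
    using ex_abs[of t] by (auto simp: scaleC_ctensor.abs_eq g_abs free_lift_scale)
  ultimately have "clinear g"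
    by (simp add: clinear_iff)
  moreover have "g (x \<otimes>\<^sub>C y) = f x y" for x y
    by (simp add: elem_tensor.abs_eq g_abs free_lift_single scaleC_one)
  ultimately have "\<exists>!g. clinear g \<and> (\<forall>x y. g (x \<otimes>\<^sub>C y) = f x y)"
    by (intro ex1I[of _ g]) (auto intro!: tensor_lift_unique)
  from theI'[OF this] show "clinear (tensor_lift f)" "tensor_lift f (x \<otimes>\<^sub>C y) = f x y"
    by (simp_all add: tensor_lift_def)
qed

lemma tensor_lift_linear:
  assumes "cbilinear f"
  shows "tensor_lift f 0 = 0" "tensor_lift f (s + t) = tensor_lift f s + tensor_lift f t"
    "tensor_lift f (c *\<^sub>C t) = c *\<^sub>C tensor_lift f t"
  using clinear_tensor_lift[OF assms] by (simp_all add: clinear_zero) (simp_all add: clinear_iff)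

lemma tensor_lift_add:
  assumes "cbilinear f" "cbilinear g" "cbilinear (\<lambda>x y. f x y + g x y)"
  shows "tensor_lift (\<lambda>x y. f x y + g x y) t = tensor_lift f t + tensor_lift g t"
  by (induction t rule: ctensor_induct)
    (simp_all add: tensor_lift_elem tensor_lift_linear assms)

lemma tensor_lift_scale:
  assumes "cbilinear f" "cbilinear (\<lambda>x y. c *\<^sub>C f x y)"
  shows "tensor_lift (\<lambda>x y. c *\<^sub>C f x y) t = c *\<^sub>C tensor_lift f t"
  by (induction t rule: ctensor_induct)
    (simp_all add: tensor_lift_elem tensor_lift_linear assms scaleC_add_right)

lemma elem_tensor_simps:
  fixes x x' :: "'a::complex_vector" and y y' :: "'b::complex_vector"
  shows
  "(x + x') \<otimes>\<^sub>C y = x \<otimes>\<^sub>C y + x' \<otimes>\<^sub>C y" "x \<otimes>\<^sub>C (y + y') = x \<otimes>\<^sub>C y + x \<otimes>\<^sub>C y'"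
  "(c *\<^sub>C x) \<otimes>\<^sub>C y = c *\<^sub>C (x \<otimes>\<^sub>C y)" "x \<otimes>\<^sub>C (c *\<^sub>C y) = c *\<^sub>C (x \<otimes>\<^sub>C y)"
  using cbilinear_elem_tensor[where ?'a = 'a and ?'b = 'b]
  by (simp_all add: cbilinear_def clinear_iff)


section \<open>PL-spaces\<close>

definition module_act :: "('h::complex_vector \<Rightarrow> 'h) \<Rightarrow> ('h, 'e::complex_vector) ctensor \<Rightarrow> ('h, 'e) ctensor"
  where "module_act a = tensor_lift (\<lambda>\<xi> x. a \<xi> \<otimes>\<^sub>C x)"

definition amplification :: "('e::complex_vector \<Rightarrow> 'f::complex_vector)
    \<Rightarrow> ('h::complex_vector, 'e) ctensor \<Rightarrow> ('h, 'f) ctensor"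
  where "amplification \<phi> = tensor_lift (\<lambda>\<xi> x. \<xi> \<otimes>\<^sub>C \<phi> x)"

lemma module_act_elem:
  assumes "clinear a"
  shows "module_act a (\<xi> \<otimes>\<^sub>C x) = a \<xi> \<otimes>\<^sub>C x"
  unfolding module_act_def using assms
  by (subst tensor_lift_elem) (auto simp: cbilinear_def clinear_iff elem_tensor_simps)

lemma amplification_elem:
  assumes "clinear \<phi>"
  shows "amplification \<phi> (\<xi> \<otimes>\<^sub>C x) = \<xi> \<otimes>\<^sub>C \<phi> x"
  unfolding amplification_def using assms
  by (subst tensor_lift_elem) (auto simp: cbilinear_def clinear_iff elem_tensor_simps)

text \<open>Norms on linear spaces that carry several norms (nonnegativity follows).\<close>

definition is_cnorm :: "('v::complex_vector \<Rightarrow> real) \<Rightarrow> bool"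
  where "is_cnorm N \<longleftrightarrow> (\<forall>u v. N (u + v) \<le> N u + N v) \<and> (\<forall>c u. N (c *\<^sub>C u) = cmod c * N u)
    \<and> (\<forall>u. N u = 0 \<longrightarrow> u = 0)"

text \<open>A PL-space is a linear space \<open>'e\<close> together with a PL-norm on the tensor product of \<open>'h\<close>
  and \<open>'e\<close>; it is represented by that norm.\<close>

definition PL_space :: "(('h::chilbert_space, 'e::complex_vector) ctensor \<Rightarrow> real) \<Rightarrow> bool"
  where "PL_space N \<longleftrightarrow> is_cnorm N
    \<and> (\<forall>a u. bounded_clinear a \<longrightarrow> N (module_act a u) \<le> onorm a * N u)"

definition underlying_norm :: "(('h::chilbert_space, 'e::complex_vector) ctensor \<Rightarrow> real) \<Rightarrow> 'e \<Rightarrow> real"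
  where "underlying_norm N x = N ((SOME \<xi>. norm \<xi> = 1) \<otimes>\<^sub>C x)"

lemma underlying_norm_eq:
  fixes N :: "('h::chilbert_space, 'e::complex_vector) ctensor \<Rightarrow> real"
  assumes N: "PL_space N" and \<xi>: "norm \<xi> = 1"
  shows "underlying_norm N x = N (\<xi> \<otimes>\<^sub>C x)"
proof -
  have le: "N (\<eta> \<otimes>\<^sub>C x) \<le> N (\<xi> \<otimes>\<^sub>C x)" if \<xi>: "norm \<xi> = 1" and \<eta>: "norm \<eta> = 1" for \<xi> \<eta> :: 'h
  proof -
    define a where "a \<zeta> = cinner \<xi> \<zeta> *\<^sub>C \<eta>" for \<zeta>
    have lin: "clinear a"
      by (simp add: a_def clinear_iff
          cinner_add_right cinner_scaleC_right scaleC_add_left scaleC_scaleC)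
    have bound: "norm (a \<zeta>) \<le> norm \<zeta> * 1" for \<zeta>
    proof -
      define c where "c = cinner \<xi> \<zeta>"
      have c': "cinner \<zeta> \<xi> = cnj c" unfolding c_def by (rule cinner_commute)
      have one: "cinner \<xi> \<xi> = 1" using \<xi> by (simp add: cinner_self)
      have add_left: "cinner (u + v) w = cinner u w + cinner v w" for u v w :: 'h
        by (metis cinner_commute cinner_add_right complex_cnj_add)
      have scale_left: "cinner (d *\<^sub>C u) w = cnj d * cinner u w" for d and u w :: 'h
        by (metis cinner_commute cinner_scaleC_right complex_cnj_mult)
      have "cinner (\<zeta> + (- c) *\<^sub>C \<xi>) (\<zeta> + (- c) *\<^sub>C \<xi>) = cinner \<zeta> \<zeta> - c * cnj c"
        by (simp only: add_left cinner_add_right scale_left cinner_scaleC_right)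
          (simp add: one c' c_def[symmetric])
      then have "complex_of_real ((norm (\<zeta> + (- c) *\<^sub>C \<xi>))\<^sup>2) = cinner \<zeta> \<zeta> - c * cnj c"
        by (simp only: cinner_self)
      also have "\<dots> = complex_of_real ((norm \<zeta>)\<^sup>2 - (cmod c)\<^sup>2)"
        by (simp only: cinner_self complex_norm_square of_real_diff)
      finally have "(norm (\<zeta> + (- c) *\<^sub>C \<xi>))\<^sup>2 = (norm \<zeta>)\<^sup>2 - (cmod c)\<^sup>2"
        by (simp only: of_real_eq_iff)
      then have "(cmod c)\<^sup>2 \<le> (norm \<zeta>)\<^sup>2"
        using zero_le_power2[of "norm (\<zeta> + (- c) *\<^sub>C \<xi>)"] by linarith
      then have "cmod c \<le> norm \<zeta>" by (rule power2_le_imp_le) simp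
      then show ?thesis using \<eta> by (simp add: a_def c_def norm_scaleC)
    qed
    have "linear a"
      using lin by (simp add: linear_iff clinear_iff scaleR_scaleC)
    then have bl: "bounded_linear a"
      using bound by (intro bounded_linear_intro[where K = 1]) (auto simp: linear_iff)
    have on: "onorm a \<le> 1"
      using bound by (intro onorm_bound) (auto simp: mult.commute)
    have bil: "cbilinear (\<lambda>\<xi> x. a \<xi> \<otimes>\<^sub>C (x :: 'e))"
      using lin cbilinear_elem_tensor[where ?'a = 'h and ?'b = 'e]
      by (simp add: cbilinear_def clinear_iff)
    have "a \<xi> = \<eta>" using \<xi> by (simp add: a_def cinner_self scaleC_one)
    then have act: "module_act a (\<xi> \<otimes>\<^sub>C x) = \<eta> \<otimes>\<^sub>C x"
      by (simp add: module_act_def tensor_lift_elem[OF bil])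
    have N0: "N 0 = 0" and Nneg: "N (- u) = N u" for u
    proof -
      have sc: "N (c *\<^sub>C v) = cmod c * N v" for c v
        using N by (simp add: PL_space_def is_cnorm_def)
      show "N 0 = 0" using sc[of 0 0] by simp
      show "N (- u) = N u" using sc[of "- 1" u] by simp
    qed
    have nonneg: "0 \<le> N u" for u
    proof -
      have "N (u + - u) \<le> N u + N (- u)"
        using N unfolding PL_space_def is_cnorm_def by blast
      then show ?thesis using N0 Nneg by simp
    qed
    have "N (module_act a (\<xi> \<otimes>\<^sub>C x)) \<le> onorm a * N (\<xi> \<otimes>\<^sub>C x)"
      using N lin bl by (simp add: PL_space_def bounded_clinear_def)
    also have "\<dots> \<le> 1 * N (\<xi> \<otimes>\<^sub>C x)"
      using on nonneg by (rule mult_right_mono)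
    finally show ?thesis by (simp add: act)
  qed
  have some: "norm (SOME \<xi> :: 'h. norm \<xi> = 1) = 1" using \<xi> by (rule someI)
  show ?thesis unfolding underlying_norm_def by (rule order_antisym[OF le[OF \<xi> some] le[OF some \<xi>]])
qed

definition PL_complete :: "(('h::chilbert_space, 'e::complex_vector) ctensor \<Rightarrow> real) \<Rightarrow> bool"
  where "PL_complete N \<longleftrightarrow>
    (\<forall>s :: nat \<Rightarrow> 'e. (\<forall>\<epsilon>>0. \<exists>M. \<forall>m\<ge>M. \<forall>n\<ge>M. underlying_norm N (s m - s n) < \<epsilon>)
      \<longrightarrow> (\<exists>x. (\<lambda>n. underlying_norm N (s n - x)) \<longlonglongrightarrow> 0))"

definition L_isometric :: "(('h::chilbert_space, 'e::complex_vector) ctensor \<Rightarrow> real)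
    \<Rightarrow> (('h, 'f::complex_vector) ctensor \<Rightarrow> real) \<Rightarrow> ('e \<Rightarrow> 'f) \<Rightarrow> bool"
  where "L_isometric N\<^sub>1 N\<^sub>2 \<phi> \<longleftrightarrow> clinear \<phi> \<and> (\<forall>u. N\<^sub>2 (amplification \<phi> u) = N\<^sub>1 u)"

definition L_isometric_isomorphism :: "(('h::chilbert_space, 'e::complex_vector) ctensor \<Rightarrow> real)
    \<Rightarrow> (('h, 'f::complex_vector) ctensor \<Rightarrow> real) \<Rightarrow> ('e \<Rightarrow> 'f) \<Rightarrow> bool"
  where "L_isometric_isomorphism N\<^sub>1 N\<^sub>2 \<phi> \<longleftrightarrow> L_isometric N\<^sub>1 N\<^sub>2 \<phi> \<and> bij \<phi>
    \<and> bij (amplification \<phi> :: ('h, 'e) ctensor \<Rightarrow> ('h, 'f) ctensor)"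

text \<open>\<open>PL_completion N N' j\<close>: the PL-space \<open>('g, N')\<close>, with the canonical map \<open>j : 'e \<rightarrow> 'g\<close>, is the
  completion of the PL-space \<open>('e, N)\<close>. As the completion of \<open>'e\<close> depends on the norm, it cannot
  be a type constructor, and it is specified by what determines it up to canonical isomorphism.
  The last clause says that \<open>N'\<close> is induced from the completion of the normed space
  \<open>('h \<otimes> 'e, N)\<close>: the natural embedding takes \<open>\<Sum>i<m. \<xi> i \<otimes> x i\<close>, where \<open>x i\<close> is the limit of
  \<open>s i n\<close> as \<open>n \<rightarrow> \<infinity>\<close>, to the limit of \<open>\<Sum>i<m. \<xi> i \<otimes> s i n\<close> in that completion, whose norm is
  the limit of the norms.\<close>

definition PL_completion :: "(('h::chilbert_space, 'e::complex_vector) ctensor \<Rightarrow> real)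
    \<Rightarrow> (('h, 'g::complex_vector) ctensor \<Rightarrow> real) \<Rightarrow> ('e \<Rightarrow> 'g) \<Rightarrow> bool"
  where "PL_completion N N' j \<longleftrightarrow> PL_space N' \<and> PL_complete N'
    \<and> clinear j
    \<and> (\<forall>x. underlying_norm N' (j x) = underlying_norm N x)
    \<and> (\<forall>y. \<exists>s. (\<lambda>n. underlying_norm N' (j (s n) - y)) \<longlonglongrightarrow> 0)
    \<and> (\<forall>(m::nat) \<xi> x s.
        (\<forall>i<m. (\<lambda>n. underlying_norm N' (j (s i n) - x i)) \<longlonglongrightarrow> 0) \<longrightarrow>
        (\<lambda>n::nat. N (\<Sum>i<m. \<xi> i \<otimes>\<^sub>C s i n)) \<longlonglongrightarrow> N' (\<Sum>i<m. \<xi> i \<otimes>\<^sub>C x i))"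

definition extension_by_continuity :: "(('h::chilbert_space, 'g\<^sub>1::complex_vector) ctensor \<Rightarrow> real)
    \<Rightarrow> (('h, 'g\<^sub>2::complex_vector) ctensor \<Rightarrow> real) \<Rightarrow> ('e\<^sub>1 \<Rightarrow> 'g\<^sub>1) \<Rightarrow> ('e\<^sub>2 \<Rightarrow> 'g\<^sub>2)
    \<Rightarrow> ('e\<^sub>1 \<Rightarrow> 'e\<^sub>2) \<Rightarrow> ('g\<^sub>1 \<Rightarrow> 'g\<^sub>2) \<Rightarrow> bool"
  where "extension_by_continuity N\<^sub>1 N\<^sub>2 j\<^sub>1 j\<^sub>2 \<phi> \<psi> \<longleftrightarrow> (\<forall>x. \<psi> (j\<^sub>1 x) = j\<^sub>2 (\<phi> x))
    \<and> (\<forall>s y. (\<lambda>n::nat. underlying_norm N\<^sub>1 (s n - y)) \<longlonglongrightarrow> 0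
        \<longrightarrow> (\<lambda>n. underlying_norm N\<^sub>2 (\<psi> (s n) - \<psi> y)) \<longlonglongrightarrow> 0)"


section \<open>Tensor products of PL-spaces\<close>

definition projective_norm :: "('a::complex_vector \<Rightarrow> real) \<Rightarrow> ('b::complex_vector \<Rightarrow> real)
    \<Rightarrow> ('a, 'b) ctensor \<Rightarrow> real"
  where "projective_norm N\<^sub>1 N\<^sub>2 t =
    Inf {\<Sum>k<n. N\<^sub>1 (x k) * N\<^sub>2 (y k) |(n::nat) x y. t = (\<Sum>k<n. x k \<otimes>\<^sub>C y k)}"

definition max_PL_norm :: "('h::chilbert_space, 'e::complex_normed_vector) ctensor \<Rightarrow> real"
  where "max_PL_norm = projective_norm norm norm"

definition tensor_swap :: "('h::complex_vector, ('e::complex_vector, 'f::complex_vector) ctensor) ctensor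
    \<Rightarrow> ('e, ('h, 'f) ctensor) ctensor"
  where "tensor_swap = tensor_lift (\<lambda>\<xi>. tensor_lift (\<lambda>x y. x \<otimes>\<^sub>C (\<xi> \<otimes>\<^sub>C y)))"

lemma tensor_swap_elem:
  fixes \<xi> :: "'a::complex_vector" and x :: "'b::complex_vector" and y :: "'c::complex_vector"
  shows "tensor_swap (\<xi> \<otimes>\<^sub>C (x \<otimes>\<^sub>C y)) = x \<otimes>\<^sub>C (\<xi> \<otimes>\<^sub>C y)"
proof -
  have inner: "cbilinear (\<lambda>(x::'b) (y::'c). x \<otimes>\<^sub>C ((\<xi>::'a) \<otimes>\<^sub>C y))" for \<xi>
    by (simp add: cbilinear_def clinear_iff elem_tensor_simps)
  have sum: "cbilinear (\<lambda>(x::'b) (y::'c). x \<otimes>\<^sub>C ((\<xi>::'a) \<otimes>\<^sub>C y) + x \<otimes>\<^sub>C (\<xi>' \<otimes>\<^sub>C y))" for \<xi> \<xi>'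
    by (simp add: cbilinear_def clinear_iff elem_tensor_simps scaleC_add_right algebra_simps)
  have scale: "cbilinear (\<lambda>(x::'b) (y::'c). c *\<^sub>C (x \<otimes>\<^sub>C ((\<xi>::'a) \<otimes>\<^sub>C y)))" for c \<xi>
    by (simp add: cbilinear_def clinear_iff elem_tensor_simps scaleC_add_right scaleC_scaleC mult.commute)
  have "cbilinear (\<lambda>\<xi>::'a. tensor_lift (\<lambda>(x::'b) (y::'c). x \<otimes>\<^sub>C (\<xi> \<otimes>\<^sub>C y)))"
    unfolding cbilinear_def
  proof (intro conjI allI)
    show "clinear (tensor_lift (\<lambda>(x::'b) (y::'c). x \<otimes>\<^sub>C ((\<xi>::'a) \<otimes>\<^sub>C y)))" for \<xi>
      by (rule clinear_tensor_lift[OF inner])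
    show "clinear (\<lambda>\<xi>::'a. tensor_lift (\<lambda>(x::'b) (y::'c). x \<otimes>\<^sub>C (\<xi> \<otimes>\<^sub>C y)) t)" for t
      by (simp add: clinear_iff elem_tensor_simps tensor_lift_add inner sum tensor_lift_scale scale)
  qed
  then show ?thesis unfolding tensor_swap_def by (simp add: tensor_lift_elem inner)
qed

definition p_PL_norm :: "(('h::chilbert_space, 'f::complex_vector) ctensor \<Rightarrow> real)
    \<Rightarrow> ('h, ('e::complex_normed_vector, 'f) ctensor) ctensor \<Rightarrow> real"
  where "p_PL_norm N U = projective_norm norm N (tensor_swap U)"

text \<open>In \<open>diamond D u v\<close> and \<open>pl_norm D N\<^sub>1 N\<^sub>2\<close>, \<open>D\<close> is the diamond operation on the Hilbert
  space itself.\<close>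

definition diamond :: "('h::complex_vector \<Rightarrow> 'h \<Rightarrow> 'h) \<Rightarrow> ('h, 'e::complex_vector) ctensor
    \<Rightarrow> ('h, 'f::complex_vector) ctensor \<Rightarrow> ('h, ('e, 'f) ctensor) ctensor"
  where "diamond D u v =
    tensor_lift (\<lambda>\<xi> x. tensor_lift (\<lambda>\<eta> y. D \<xi> \<eta> \<otimes>\<^sub>C (x \<otimes>\<^sub>C y)) v) u"

lemma diamond_elem:
  fixes x :: "'e::complex_vector" and y :: "'f::complex_vector"
  assumes "cbilinear D"
  shows "diamond D (\<xi> \<otimes>\<^sub>C x) (\<eta> \<otimes>\<^sub>C y) = D \<xi> \<eta> \<otimes>\<^sub>C (x \<otimes>\<^sub>C y)"
proof -
  note D = assms[unfolded cbilinear_def clinear_iff]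
  have inner: "cbilinear (\<lambda>\<eta> (y::'f). D \<xi> \<eta> \<otimes>\<^sub>C ((x::'e) \<otimes>\<^sub>C y))" for \<xi> x
    using D by (simp add: cbilinear_def clinear_iff elem_tensor_simps)
  have sum: "cbilinear (\<lambda>\<eta> (y::'f). D \<xi> \<eta> \<otimes>\<^sub>C ((x::'e) \<otimes>\<^sub>C y) + D \<xi>' \<eta> \<otimes>\<^sub>C ((x'::'e) \<otimes>\<^sub>C y))" for \<xi> \<xi>' x x'
    using D by (simp add: cbilinear_def clinear_iff elem_tensor_simps scaleC_add_right algebra_simps)
  have scale: "cbilinear (\<lambda>\<eta> (y::'f). c *\<^sub>C (D \<xi> \<eta> \<otimes>\<^sub>C ((x::'e) \<otimes>\<^sub>C y)))" for c \<xi> x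
    using D by (simp add: cbilinear_def clinear_iff elem_tensor_simps scaleC_add_right scaleC_scaleC mult.commute)
  have outer: "cbilinear (\<lambda>\<xi> (x::'e). tensor_lift (\<lambda>\<eta> (y::'f). D \<xi> \<eta> \<otimes>\<^sub>C (x \<otimes>\<^sub>C y)) v)" for v
    using D by (simp add: cbilinear_def clinear_iff elem_tensor_simps
        tensor_lift_add[OF inner inner sum] tensor_lift_scale[OF inner scale])
  show ?thesis
    unfolding diamond_def by (rule trans[OF tensor_lift_elem[OF outer] tensor_lift_elem[OF inner]])
qed

definition pl_norm :: "('h::chilbert_space \<Rightarrow> 'h \<Rightarrow> 'h)
    \<Rightarrow> (('h, 'e::complex_vector) ctensor \<Rightarrow> real) \<Rightarrow> (('h, 'f::complex_vector) ctensor \<Rightarrow> real)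
    \<Rightarrow> ('h, ('e, 'f) ctensor) ctensor \<Rightarrow> real"
  where "pl_norm D N\<^sub>1 N\<^sub>2 U =
    Inf {\<Sum>k<n. onorm (a k) * N\<^sub>1 (u k) * N\<^sub>2 (v k) |(n::nat) a u v.
      (\<forall>k<n. bounded_clinear (a k)) \<and> U = (\<Sum>k<n. module_act (a k) (diamond D (u k) (v k)))}"

end

theory Submission
  imports Defs
begin

text \<open>Both norms on \<open>H(E \<otimes> F)\<close> agree, so \<open>I\<close> is the identity. Under the swap, \<open>a \<cdot> (\<xi>x \<diamondsuit> v)\<close> becomes
  \<open>x \<otimes> (a S\<^sub>\<xi>) \<cdot> v\<close> with \<open>S\<^sub>\<xi> \<eta> = \<xi> \<diamondsuit> \<eta>\<close>; since \<open>\<parallel>a S\<^sub>\<xi>\<parallel> \<le> \<parallel>a\<parallel>\<parallel>\<xi>\<parallel>\<close>, expanding \<open>u\<close> into elementary tensors bounds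
  the projective norm by the \<open>pl\<close>-norm. Conversely, for a unit vector \<open>e\<close> the isometry \<open>S\<^sub>e\<close> has a left
  inverse \<open>a\<close> of norm at most 1, and then \<open>x \<otimes> v\<close> is the swap of \<open>a \<cdot> (ex \<diamondsuit> v)\<close>.

  For the completions, relate \<open>y\<close> and \<open>z\<close> if \<open>j\<^sub>1 s\<^sub>n \<longlonglongrightarrow> y\<close> and \<open>j\<^sub>2 s\<^sub>n \<longlonglongrightarrow> z\<close> for a common sequence
  \<open>s\<close>. The norms of \<open>\<Sum> \<xi>\<^sub>i y\<^sub>i\<close> and \<open>\<Sum> \<xi>\<^sub>i z\<^sub>i\<close> are then limits of the same sequence, so the relation is the
  graph of an \<open>L\<close>-isometric isomorphism.\<close>

section \<open>Left inverses of Hilbert space isometries\<close>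

lemma clinear_imp_linear: "clinear f \<Longrightarrow> linear f"
  by (simp add: linear_iff clinear_iff scaleR_scaleC)

lemma clinear_add: "clinear f \<Longrightarrow> f (x + y) = f x + f y"
  and clinear_scaleC: "clinear f \<Longrightarrow> f (c *\<^sub>C x) = c *\<^sub>C f x"
  by (simp_all add: clinear_iff)

lemma clinear_sum: "clinear f \<Longrightarrow> f (\<Sum>i\<in>A. g i) = (\<Sum>i\<in>A. f (g i))"
  by (simp add: clinear_imp_linear linear_sum)

lemma clinear_diff: "clinear f \<Longrightarrow> f (x - y) = f x - f y"
  by (simp add: clinear_imp_linear linear_diff)

lemma scaleC_minus_one: "(- 1) *\<^sub>C x = - (x :: 'a::complex_vector)"
  using complex_vector.scale_minus_left[of 1 x] by (simp add: scaleC_one)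

lemma cinner_add_left: "cinner (x + y) z = cinner x z + cinner y z"
  by (metis cinner_commute cinner_add_right complex_cnj_add)

lemma cinner_scaleC_left: "cinner (c *\<^sub>C x) y = cnj c * cinner x y"
  by (metis cinner_commute cinner_scaleC_right complex_cnj_mult)

lemma cinner_diff_right: "cinner x (y - z) = cinner x y - cinner x z"
  using cinner_add_right[of x "y - z" z] by simp

lemma norm_add_square: "(norm (x + y))\<^sup>2 = (norm x)\<^sup>2 + (norm y)\<^sup>2 + 2 * Re (cinner x y)"
  for x y :: "'a::complex_inner"
proof -
  have "Re (cinner (x + y) (x + y)) = Re (cinner x x) + Re (cinner y y) + 2 * Re (cinner x y)"
    using cinner_commute[of y x] by (simp add: cinner_add_left cinner_add_right)
  then show ?thesis by (simp add: cinner_self)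
qed

lemma parallelogram_law:
  "(norm (x + y))\<^sup>2 + (norm (x - y))\<^sup>2 = 2 * (norm x)\<^sup>2 + 2 * (norm y)\<^sup>2"
  for x y :: "'a::complex_inner"
proof -
  have "cinner x (- y) = - cinner x y"
    using cinner_scaleC_right[of x "- 1" y] by (simp add: scaleC_minus_one)
  then show ?thesis
    using norm_add_square[of x y] norm_add_square[of x "- y"] by simp
qed

text \<open>Minimality is tested at the coefficient \<open>c\<close> that minimises
  \<open>norm (r + c *\<^sub>C p)\<close>. There the square of the norm drops by |t|^2 / ||p||^2
  with \<open>t = cinner p r\<close>, so \<open>t\<close> must vanish.\<close>

lemma orthogonal_if_norm_minimal:
  fixes r p :: "'a::complex_inner"
  assumes "\<And>c. norm r \<le> norm (r + c *\<^sub>C p)"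
  shows "cinner p r = 0"
proof (cases "p = 0")
  case True
  then show ?thesis using cinner_scaleC_left[of 0 p r] by simp
next
  case False
  define t where "t = cinner p r"
  define c where "c = - (t / complex_of_real ((norm p)\<^sup>2))"
  have n0: "norm p \<noteq> 0" using False by simp
  have "cinner r (c *\<^sub>C p) = c * cnj t"
    unfolding cinner_scaleC_right t_def by (metis cinner_commute)
  also have "\<dots> = - complex_of_real ((cmod t)\<^sup>2 / (norm p)\<^sup>2)"
    by (simp add: c_def flip: complex_norm_square)
  finally have "Re (cinner r (c *\<^sub>C p)) = - ((cmod t)\<^sup>2 / (norm p)\<^sup>2)" by simp
  moreover have "(norm (c *\<^sub>C p))\<^sup>2 = (cmod t)\<^sup>2 / (norm p)\<^sup>2"
    using n0 by (simp add: norm_scaleC c_def norm_divide norm_mult power2_eq_square)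
  moreover have "(norm r)\<^sup>2 \<le> (norm (r + c *\<^sub>C p))\<^sup>2"
    using assms by (simp add: power_mono)
  ultimately have "(cmod t)\<^sup>2 / (norm p)\<^sup>2 \<le> 0"
    using norm_add_square[of r "c *\<^sub>C p"] by linarith
  then have "t = 0" using n0 by (simp add: divide_le_0_iff)
  then show ?thesis by (simp add: t_def)
qed

text \<open>\<open>S \<eta>\<close> is the point of the range of \<open>S\<close> nearest to
  \<open>\<zeta>\<close>. The minimising sequence is taken in the domain of \<open>S\<close>: it is
  Cauchy there because \<open>S\<close> is isometric, and the domain is complete.\<close>

lemma isometry_orthogonal_projection:
  fixes S :: "'a::chilbert_space \<Rightarrow> 'b::complex_inner"
  assumes lin: "clinear S" and iso: "\<And>\<eta>. norm (S \<eta>) = norm \<eta>"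
  obtains \<eta> where "\<And>\<theta>. cinner (S \<theta>) (\<zeta> - S \<eta>) = 0"
proof -
  define f where "f \<eta> = (norm (\<zeta> - S \<eta>))\<^sup>2" for \<eta>
  define d where "d = Inf (range f)"
  have bdd: "bdd_below (range f)" by (rule bdd_belowI[of _ 0]) (auto simp: f_def)
  have d_le: "d \<le> f \<eta>" for \<eta> unfolding d_def by (rule cInf_lower) (auto simp: bdd)
  have "\<exists>\<eta>. f \<eta> < d + inverse (real (Suc n))" for n
    using cInf_lessD[of "range f" "d + inverse (real (Suc n))"] by (auto simp: d_def)
  then obtain h where h: "f (h n) < d + inverse (real (Suc n))" for n by metis
  have close: "(norm (h m - h n))\<^sup>2 \<le> 2 * inverse (real (Suc m)) + 2 * inverse (real (Suc n))"
    for m n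
  proof -
    \<comment> \<open>The image of the midpoint is again a competitor, so
      \<open>d \<le> f g\<close>. The parallelogram law for the two residuals then bounds the
      distance of \<open>h m\<close> and \<open>h n\<close> by their excess over
      \<open>d\<close>.\<close>
    define g where "g = (1/2) *\<^sub>C (h m + h n)"
    have "S g = (1/2) *\<^sub>C (S (h m) + S (h n))"
      by (simp add: g_def clinear_add[OF lin] clinear_scaleC[OF lin])
    then have "(\<zeta> - S (h m)) + (\<zeta> - S (h n)) = 2 *\<^sub>C (\<zeta> - S g)"
      by (simp add: complex_vector.scale_right_diff_distrib scaleC_scaleC scaleC_one
          scaleC_add_left[of 1 1, simplified])
    then have sum: "(norm ((\<zeta> - S (h m)) + (\<zeta> - S (h n))))\<^sup>2 = 4 * f g"
      by (simp add: norm_scaleC f_def power_mult_distrib)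
    have "(\<zeta> - S (h n)) - (\<zeta> - S (h m)) = S (h m - h n)"
      by (simp add: clinear_diff[OF lin])
    then have "(norm ((\<zeta> - S (h n)) - (\<zeta> - S (h m))))\<^sup>2 = (norm (h m - h n))\<^sup>2"
      by (simp add: iso)
    then have "4 * f g + (norm (h m - h n))\<^sup>2 = 2 * f (h m) + 2 * f (h n)"
      using parallelogram_law[of "\<zeta> - S (h n)" "\<zeta> - S (h m)"] sum by (simp add: f_def add.commute)
    then show ?thesis using d_le[of g] h[of m] h[of n] by linarith
  qed
  have "Cauchy h"
  proof (rule metric_CauchyI)
    fix e :: real assume "0 < e"
    then obtain M where M: "inverse (real (Suc M)) < e\<^sup>2 / 4"
      using reals_Archimedean[of "e\<^sup>2 / 4"] by auto
    have "dist (h m) (h n) < e" if "m \<ge> M" "n \<ge> M" for m n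
    proof -
      have "inverse (real (Suc m)) \<le> inverse (real (Suc M))"
        "inverse (real (Suc n)) \<le> inverse (real (Suc M))"
        using that by (simp_all add: le_imp_inverse_le)
      then have "(norm (h m - h n))\<^sup>2 < e\<^sup>2" using close[of m n] M by linarith
      then have "norm (h m - h n) < e"
        using \<open>0 < e\<close> by (simp add: power_less_imp_less_base)
      then show ?thesis by (simp add: dist_norm)
    qed
    then show "\<exists>M. \<forall>m\<ge>M. \<forall>n\<ge>M. dist (h m) (h n) < e" by blast
  qed
  then obtain \<eta> where lim: "h \<longlonglongrightarrow> \<eta>" using Cauchy_convergent convergent_def by blast
  have bl: "bounded_linear S"
    using clinear_imp_linear[OF lin] iso
    by (intro bounded_linear_intro[where K = 1]) (auto simp: linear_iff)
  \<comment> \<open>Continuity of \<open>S\<close> carries the values of \<open>f\<close> to the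
    limit, so \<open>\<eta>\<close> attains the infimum.\<close>
  have "(\<lambda>n. f (h n)) \<longlonglongrightarrow> f \<eta>"
    unfolding f_def by (intro tendsto_intros bounded_linear.tendsto[OF bl] lim)
  moreover have "(\<lambda>n. d + inverse (real (Suc n))) \<longlonglongrightarrow> d + 0"
    by (intro tendsto_intros LIMSEQ_inverse_real_of_nat)
  ultimately have "f \<eta> \<le> d"
    using LIMSEQ_le[of "\<lambda>n. f (h n)" "f \<eta>" "\<lambda>n. d + inverse (real (Suc n))" d] h
    by (auto intro: less_imp_le)
  then have min: "f \<eta> \<le> f \<theta>" for \<theta> using d_le order_trans by blast
  have "cinner (S \<theta>) (\<zeta> - S \<eta>) = 0" for \<theta>
  proof (rule orthogonal_if_norm_minimal)
    fix c
    \<comment> \<open>Adding a multiple of \<open>S \<theta>\<close> to the residual amounts to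
      moving the parameter \<open>\<eta>\<close>, so minimality of \<open>f \<eta>\<close>
      applies.\<close>
    have step: "\<zeta> - S (\<eta> + (- c) *\<^sub>C \<theta>) = \<zeta> - S \<eta> + c *\<^sub>C S \<theta>"
      by (simp add: clinear_diff[OF lin] clinear_scaleC[OF lin])
    have "(norm (\<zeta> - S \<eta>))\<^sup>2 \<le> (norm (\<zeta> - S \<eta> + c *\<^sub>C S \<theta>))\<^sup>2"
      using min[of "\<eta> + (- c) *\<^sub>C \<theta>"] unfolding f_def step .
    then show "norm (\<zeta> - S \<eta>) \<le> norm (\<zeta> - S \<eta> + c *\<^sub>C S \<theta>)" by (rule power2_le_imp_le) simp
  qed
  then show ?thesis by (rule that)
qed

text \<open>\<open>a\<close> is the adjoint of \<open>S\<close>: it sends \<open>\<zeta>\<close> to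
  the parameter of its orthogonal projection onto the range. Uniqueness of that parameter gives
  linearity and the inverse property, and Pythagoras gives the norm bound.\<close>

lemma isometry_left_inverse:
  fixes S :: "'a::chilbert_space \<Rightarrow> 'b::complex_inner"
  assumes lin: "clinear S" and iso: "\<And>\<eta>. norm (S \<eta>) = norm \<eta>"
  obtains a where "bounded_clinear a" "onorm a \<le> 1" "\<And>\<eta>. a (S \<eta>) = \<eta>"
proof -
  define orth where "orth \<zeta> \<eta> \<longleftrightarrow> (\<forall>\<theta>. cinner (S \<theta>) (\<zeta> - S \<eta>) = 0)" for \<zeta> \<eta>
  have "\<exists>\<eta>. orth \<zeta> \<eta>" for \<zeta>
    using isometry_orthogonal_projection[OF assms, where \<zeta> = \<zeta>] by (auto simp: orth_def)
  then obtain a where a: "orth \<zeta> (a \<zeta>)" for \<zeta> by metis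
  have unique: "\<eta> = \<eta>'" if "orth \<zeta> \<eta>" "orth \<zeta> \<eta>'" for \<zeta> \<eta> \<eta>'
  proof -
    \<comment> \<open>This vector lies in the range of \<open>S\<close> and is a difference of two
      vectors orthogonal to that range, hence is orthogonal to itself.\<close>
    have "S (\<eta> - \<eta>') = (\<zeta> - S \<eta>') - (\<zeta> - S \<eta>)" by (simp add: clinear_diff[OF lin])
    then have "cinner (S (\<eta> - \<eta>')) (S (\<eta> - \<eta>')) =
        cinner (S (\<eta> - \<eta>')) (\<zeta> - S \<eta>') - cinner (S (\<eta> - \<eta>')) (\<zeta> - S \<eta>)"
      using cinner_diff_right by metis
    then have "norm (\<eta> - \<eta>') = 0" using that by (simp add: orth_def cinner_self iso)
    then show ?thesis by simp
  qed
  have "clinear a"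
    unfolding clinear_iff
  proof (intro conjI allI)
    fix x y c
    have add: "x + y - S (a x + a y) = (x - S (a x)) + (y - S (a y))"
      by (simp add: clinear_add[OF lin])
    have "orth (x + y) (a x + a y)"
      unfolding orth_def add cinner_add_right using a[of x] a[of y] by (simp add: orth_def)
    then show "a (x + y) = a x + a y" using a unique by blast
    have scale: "c *\<^sub>C x - S (c *\<^sub>C a x) = c *\<^sub>C (x - S (a x))"
      by (simp add: clinear_scaleC[OF lin] complex_vector.scale_right_diff_distrib)
    have "orth (c *\<^sub>C x) (c *\<^sub>C a x)"
      unfolding orth_def scale cinner_scaleC_right using a[of x] by (simp add: orth_def)
    then show "a (c *\<^sub>C x) = c *\<^sub>C a x" using a unique by blast
  qed
  have bound: "norm (a \<zeta>) \<le> norm \<zeta>" for \<zeta>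
  proof -
    have "(norm \<zeta>)\<^sup>2 = (norm (a \<zeta>))\<^sup>2 + (norm (\<zeta> - S (a \<zeta>)))\<^sup>2"
      using norm_add_square[of "S (a \<zeta>)" "\<zeta> - S (a \<zeta>)"] a[of \<zeta>] by (simp add: orth_def iso)
    then have "(norm (a \<zeta>))\<^sup>2 \<le> (norm \<zeta>)\<^sup>2" by simp
    then show ?thesis by (rule power2_le_imp_le) simp
  qed
  have "bounded_clinear a"
    using \<open>clinear a\<close> clinear_imp_linear[OF \<open>clinear a\<close>] bound
    by (auto simp: bounded_clinear_def linear_iff intro!: bounded_linear_intro[where K = 1])
  moreover have "onorm a \<le> 1" using bound by (intro onorm_bound) auto
  moreover have "a (S \<eta>) = \<eta>" for \<eta>
  proof -
    have "cinner x 0 = 0" for x :: 'b using cinner_diff_right[of x 0 0] by simp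
    then have "orth (S \<eta>) \<eta>" by (simp add: orth_def)
    then show ?thesis using a unique by blast
  qed
  ultimately show ?thesis by (rule that)
qed


section \<open>Linear maps on algebraic tensor products\<close>

text \<open>Both \<open>tensor_swap\<close> and \<open>diamond\<close> nest one
  \<open>tensor_lift\<close> inside another. This supplies the linearity in the outer variable that
  the outer lift requires; it suffices to compare on elementary tensors.\<close>

lemma clinear_tensor_lift_family:
  fixes f :: "'a::complex_vector \<Rightarrow> 'b::complex_vector \<Rightarrow> 'c::complex_vector \<Rightarrow> 'd::complex_vector"
  assumes "\<And>\<xi>. cbilinear (f \<xi>)" and "\<And>x y. clinear (\<lambda>\<xi>. f \<xi> x y)"
  shows "clinear (\<lambda>\<xi>. tensor_lift (f \<xi>) t)"
proof -
  have "tensor_lift (f (\<xi> + \<xi>')) t = tensor_lift (f \<xi>) t + tensor_lift (f \<xi>') t" for \<xi> \<xi>'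
  proof (induction t rule: ctensor_induct)
    case (elem x y)
    show ?case
      unfolding tensor_lift_elem[OF assms(1)] by (rule clinear_add[OF assms(2)])
  qed (simp_all add: tensor_lift_linear[OF assms(1)])
  moreover have "tensor_lift (f (c *\<^sub>C \<xi>)) t = c *\<^sub>C tensor_lift (f \<xi>) t" for c \<xi>
  proof (induction t rule: ctensor_induct)
    case (elem x y)
    show ?case
      unfolding tensor_lift_elem[OF assms(1)] by (rule clinear_scaleC[OF assms(2)])
  qed (simp_all add: tensor_lift_linear[OF assms(1)] scaleC_add_right)
  ultimately show ?thesis by (simp add: clinear_iff)
qed

lemma elem_tensor_zero [simp]: "x \<otimes>\<^sub>C 0 = 0" "0 \<otimes>\<^sub>C y = 0"
  using elem_tensor_simps(4)[of x 0 0] elem_tensor_simps(3)[of 0 0 y] by simp_all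

lemma clinear_module_act: "clinear a \<Longrightarrow> clinear (module_act a)"
  unfolding module_act_def
  by (rule clinear_tensor_lift) (simp add: cbilinear_def clinear_iff elem_tensor_simps)

lemma clinear_amplification: "clinear \<phi> \<Longrightarrow> clinear (amplification \<phi>)"
  unfolding amplification_def
  by (rule clinear_tensor_lift) (simp add: cbilinear_def clinear_iff elem_tensor_simps)

lemma amplification_ident: "amplification (\<lambda>x. x) u = u"
proof -
  have id: "clinear (\<lambda>x::'b. x)" by (simp add: clinear_iff)
  show ?thesis
    by (induction u rule: ctensor_induct)
      (simp_all add: amplification_elem[OF id] clinear_zero[OF clinear_amplification[OF id]]
        clinear_add[OF clinear_amplification[OF id]])
qed

lemma clinear_tensor_swap: "clinear tensor_swap"
proof -
  have inner: "cbilinear (\<lambda>(x::'b) (y::'c). x \<otimes>\<^sub>C (\<xi> \<otimes>\<^sub>C y))" for \<xi> :: 'a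
    by (simp add: cbilinear_def clinear_iff elem_tensor_simps)
  have "clinear (\<lambda>\<xi>::'a. tensor_lift (\<lambda>(x::'b) (y::'c). x \<otimes>\<^sub>C (\<xi> \<otimes>\<^sub>C y)) t)" for t
    by (rule clinear_tensor_lift_family[OF inner]) (simp add: clinear_iff elem_tensor_simps)
  then have "cbilinear (\<lambda>(\<xi>::'a). tensor_lift (\<lambda>(x::'b) (y::'c). x \<otimes>\<^sub>C (\<xi> \<otimes>\<^sub>C y)))"
    using clinear_tensor_lift[OF inner] by (simp add: cbilinear_def)
  then show ?thesis unfolding tensor_swap_def by (rule clinear_tensor_lift)
qed

text \<open>The two swaps have different types: the outer one leads back with the roles of the first
  two factors exchanged. Hence the swap is a bijection, and an identity for swapped elements can be
  read backwards.\<close>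

lemma tensor_swap_swap: "tensor_swap (tensor_swap U) = U"
proof (induction U rule: ctensor_induct)
  case (elem \<xi> t)
  show ?case
    by (induction t rule: ctensor_induct)
      (simp_all add: tensor_swap_elem elem_tensor_simps clinear_add[OF clinear_tensor_swap]
        clinear_zero[OF clinear_tensor_swap])
qed (simp_all add: clinear_add[OF clinear_tensor_swap] clinear_zero[OF clinear_tensor_swap])

lemma cbilinear_diamond:
  assumes "cbilinear D"
  shows "cbilinear (diamond D :: ('h::complex_vector, 'e::complex_vector) ctensor
    \<Rightarrow> ('h, 'f::complex_vector) ctensor \<Rightarrow> _)"
proof -
  note D = assms[unfolded cbilinear_def clinear_iff]
  have inner: "cbilinear (\<lambda>\<eta> (y::'f). D \<xi> \<eta> \<otimes>\<^sub>C ((x::'e) \<otimes>\<^sub>C y))" for \<xi> x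
    using D by (simp add: cbilinear_def clinear_iff elem_tensor_simps)
  have right: "clinear (\<lambda>v. tensor_lift (\<lambda>\<eta> (y::'f). D \<xi> \<eta> \<otimes>\<^sub>C ((x::'e) \<otimes>\<^sub>C y)) v)" for \<xi> x
    by (rule clinear_tensor_lift[OF inner])
  have outer: "cbilinear (\<lambda>\<xi> (x::'e). tensor_lift (\<lambda>\<eta> (y::'f). D \<xi> \<eta> \<otimes>\<^sub>C (x \<otimes>\<^sub>C y)) v)" for v
    unfolding cbilinear_def
    by (intro conjI allI clinear_tensor_lift_family inner)
      (simp_all add: clinear_iff elem_tensor_simps D)
  show ?thesis
    unfolding cbilinear_def
  proof (intro conjI allI)
    show "clinear (\<lambda>u :: ('h, 'e) ctensor. diamond D u v)" for v :: "('h, 'f) ctensor"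
      unfolding diamond_def by (rule clinear_tensor_lift[OF outer])
    show "clinear (\<lambda>v :: ('h, 'f) ctensor. diamond D u v)" for u :: "('h, 'e) ctensor"
      unfolding diamond_def
      by (rule clinear_tensor_lift_family[OF outer right])
  qed
qed

text \<open>Only the first factor has to be elementary. Both sides are linear in \<open>v\<close>,
  so \<open>v\<close> stays whole in the norm estimates, where nothing is known of \<open>N\<close>
  but the \<open>PL\<close>-property.\<close>

lemma tensor_swap_module_act_diamond:
  assumes D: "cbilinear D" and a: "clinear a"
  shows "tensor_swap (module_act a (diamond D (\<xi> \<otimes>\<^sub>C x) v)) = x \<otimes>\<^sub>C module_act (\<lambda>\<eta>. a (D \<xi> \<eta>)) v"
proof -
  have aD: "clinear (\<lambda>\<eta>. a (D \<xi> \<eta>))"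
    using D a by (simp add: cbilinear_def clinear_iff)
  have d: "clinear (diamond D (\<xi> \<otimes>\<^sub>C x))" using cbilinear_diamond[OF D] unfolding cbilinear_def by blast
  note lin = d clinear_module_act[OF a] clinear_module_act[OF aD] clinear_tensor_swap
  show ?thesis
    by (induction v rule: ctensor_induct)
      (simp_all add: lin[THEN clinear_zero] lin[THEN clinear_add] diamond_elem[OF D]
        module_act_elem[OF a] module_act_elem[OF aD] tensor_swap_elem elem_tensor_simps)
qed


section \<open>The projective norm\<close>

lemma sum_lessThan_append:
  fixes n m :: nat
  shows "(\<Sum>k<n+m. if k < n then f k else g (k - n)) = (\<Sum>k<n. f k) + (\<Sum>k<m. g k)"
  by (induction m) (simp_all add: add.assoc cong: sum.cong_simp)

text \<open>The two concatenated families remain separate arguments of \<open>f\<close>. Read from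
  right to left with \<open>f\<close> the tensor or the product of norms, this merges two
  representations, or their costs, into one.\<close>

lemma sum_lessThan_append2:
  fixes n m :: nat
  shows "(\<Sum>k<n+m. f (if k < n then x k else x' (k - n)) (if k < n then y k else y' (k - n)))
    = (\<Sum>k<n. f (x k) (y k)) + (\<Sum>k<m. f (x' k) (y' k))"
  unfolding sum_lessThan_append[symmetric] by (rule sum.cong) simp_all

lemma ctensor_sum_obtain:
  fixes t :: "('a::complex_vector, 'b::complex_vector) ctensor"
  obtains n :: nat and x y where "t = (\<Sum>k<n. x k \<otimes>\<^sub>C y k)"
proof -
  have "\<exists>(n::nat) x y. t = (\<Sum>k<n. x k \<otimes>\<^sub>C y k)"
  proof (induction t rule: ctensor_induct)
    case zero
    show ?case by (rule exI[of _ 0]) simp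
  next
    case (elem x y)
    show ?case by (rule exI[of _ 1], rule exI[of _ "\<lambda>_. x"], rule exI[of _ "\<lambda>_. y"]) simp
  next
    case (add u v)
    then obtain n m :: nat and x y x' y' where
      uv: "u = (\<Sum>k<n. x k \<otimes>\<^sub>C y k)" "v = (\<Sum>k<m. x' k \<otimes>\<^sub>C y' k)" by blast
    show ?case unfolding uv sum_lessThan_append2[symmetric] by (intro exI) (rule refl)
  qed
  then show ?thesis using that by blast
qed

context
  fixes N\<^sub>1 :: "'a::complex_vector \<Rightarrow> real" and N\<^sub>2 :: "'b::complex_vector \<Rightarrow> real"
  assumes N\<^sub>1_nonneg: "\<And>x. 0 \<le> N\<^sub>1 x" and N\<^sub>2_nonneg: "\<And>y. 0 \<le> N\<^sub>2 y"
begin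

lemma projective_norm_le:
  fixes n :: nat
  assumes "t = (\<Sum>k<n. x k \<otimes>\<^sub>C y k)"
  shows "projective_norm N\<^sub>1 N\<^sub>2 t \<le> (\<Sum>k<n. N\<^sub>1 (x k) * N\<^sub>2 (y k))"
  unfolding projective_norm_def
  using assms by (intro cInf_lower bdd_belowI[of _ 0])
    (auto intro!: sum_nonneg mult_nonneg_nonneg N\<^sub>1_nonneg N\<^sub>2_nonneg)

text \<open>Together with the lower bound 0 from nonnegativity, this makes the \<open>Inf\<close> in
  \<open>projective_norm\<close> a genuine infimum.\<close>

lemma projective_norm_set_nonempty:
  "{\<Sum>k<n. N\<^sub>1 (x k) * N\<^sub>2 (y k) |(n::nat) x y. t = (\<Sum>k<n. x k \<otimes>\<^sub>C y k)} \<noteq> {}"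
proof -
  obtain n :: nat and x y where "t = (\<Sum>k<n. x k \<otimes>\<^sub>C y k)" by (rule ctensor_sum_obtain)
  then show ?thesis by blast
qed

lemma projective_norm_approx:
  assumes "0 < \<epsilon>"
  obtains n :: nat and x y where "t = (\<Sum>k<n. x k \<otimes>\<^sub>C y k)"
    and "(\<Sum>k<n. N\<^sub>1 (x k) * N\<^sub>2 (y k)) < projective_norm N\<^sub>1 N\<^sub>2 t + \<epsilon>"
proof -
  have "projective_norm N\<^sub>1 N\<^sub>2 t < projective_norm N\<^sub>1 N\<^sub>2 t + \<epsilon>" using assms by simp
  from cInf_lessD[OF projective_norm_set_nonempty this[unfolded projective_norm_def[of _ _ t]]]
  show ?thesis using that unfolding projective_norm_def by blast
qed

lemma projective_norm_nonneg: "0 \<le> projective_norm N\<^sub>1 N\<^sub>2 t"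
  unfolding projective_norm_def
  by (rule cInf_greatest[OF projective_norm_set_nonempty])
    (auto intro!: sum_nonneg mult_nonneg_nonneg N\<^sub>1_nonneg N\<^sub>2_nonneg)

lemma projective_norm_elem_le: "projective_norm N\<^sub>1 N\<^sub>2 (x \<otimes>\<^sub>C y) \<le> N\<^sub>1 x * N\<^sub>2 y"
  using projective_norm_le[of "x \<otimes>\<^sub>C y" "\<lambda>_. x" "\<lambda>_. y" 1] by simp

text \<open>Concatenating representations that are optimal up to \<open>\<epsilon> / 2\<close> gives
  a representation of the sum.\<close>

lemma projective_norm_add:
  "projective_norm N\<^sub>1 N\<^sub>2 (s + t) \<le> projective_norm N\<^sub>1 N\<^sub>2 s + projective_norm N\<^sub>1 N\<^sub>2 t"
proof (rule field_le_epsilon)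
  fix \<epsilon> :: real assume "0 < \<epsilon>"
  then have half: "0 < \<epsilon> / 2" by simp
  obtain n :: nat and x y where s: "s = (\<Sum>k<n. x k \<otimes>\<^sub>C y k)"
    "(\<Sum>k<n. N\<^sub>1 (x k) * N\<^sub>2 (y k)) < projective_norm N\<^sub>1 N\<^sub>2 s + \<epsilon> / 2"
    by (rule projective_norm_approx[OF half])
  obtain m :: nat and x' y' where t: "t = (\<Sum>k<m. x' k \<otimes>\<^sub>C y' k)"
    "(\<Sum>k<m. N\<^sub>1 (x' k) * N\<^sub>2 (y' k)) < projective_norm N\<^sub>1 N\<^sub>2 t + \<epsilon> / 2"
    by (rule projective_norm_approx[OF half])
  have "projective_norm N\<^sub>1 N\<^sub>2 (s + t)
      \<le> (\<Sum>k<n. N\<^sub>1 (x k) * N\<^sub>2 (y k)) + (\<Sum>k<m. N\<^sub>1 (x' k) * N\<^sub>2 (y' k))"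
    unfolding s(1) t(1) sum_lessThan_append2[symmetric, of "(\<otimes>\<^sub>C)"]
      sum_lessThan_append2[symmetric, of "\<lambda>x y. N\<^sub>1 x * N\<^sub>2 y"]
    by (rule projective_norm_le[OF refl])
  then show "projective_norm N\<^sub>1 N\<^sub>2 (s + t)
      \<le> projective_norm N\<^sub>1 N\<^sub>2 s + projective_norm N\<^sub>1 N\<^sub>2 t + \<epsilon>"
    using s(2) t(2) by linarith
qed

lemma projective_norm_sum:
  fixes n :: nat
  shows "projective_norm N\<^sub>1 N\<^sub>2 (\<Sum>k<n. t k) \<le> (\<Sum>k<n. projective_norm N\<^sub>1 N\<^sub>2 (t k))"
proof (induction n)
  case 0
  \<comment> \<open>The empty representation of 0 has cost 0; \<open>x\<close> and \<open>y\<close>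
    are arbitrary here.\<close>
  show ?case using projective_norm_le[of 0 x y 0] by simp
next
  case (Suc n)
  show ?case using projective_norm_add[of "\<Sum>k<n. t k" "t n"] Suc by simp
qed

end

section \<open>First consequences of the norm axioms\<close>

lemma is_cnorm_zero: "is_cnorm N \<Longrightarrow> N 0 = 0"
  unfolding is_cnorm_def by (metis complex_vector.scale_zero_left norm_zero mult_zero_left)

lemma is_cnorm_nonneg:
  assumes "is_cnorm N"
  shows "0 \<le> N u"
proof -
  have "N (u + (- 1) *\<^sub>C u) \<le> N u + cmod (- 1) * N u"
    using assms unfolding is_cnorm_def by metis
  then show ?thesis using is_cnorm_zero[OF assms] by (simp add: scaleC_minus_one)
qed


section \<open>The coincidence of the two norms\<close>

text \<open>\<open>D \<xi>\<close> is the operator \<open>S\<^sub>\<xi>\<close> of the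
  overview.\<close>

lemma bounded_clinear_partial:
  assumes D: "cbilinear D" and norm_D: "\<And>\<xi> \<eta>. norm (D \<xi> \<eta>) = norm \<xi> * norm \<eta>"
  shows "bounded_clinear (D \<xi>)" and "onorm (D \<xi>) \<le> norm \<xi>"
proof -
  have "clinear (D \<xi>)" using D by (simp add: cbilinear_def)
  then show "bounded_clinear (D \<xi>)"
    using clinear_imp_linear[OF \<open>clinear (D \<xi>)\<close>] norm_D
    by (auto simp: bounded_clinear_def linear_iff mult.commute
        intro!: bounded_linear_intro[where K = "norm \<xi>"])
  show "onorm (D \<xi>) \<le> norm \<xi>" using norm_D by (intro onorm_bound) auto
qed

lemma bounded_clinear_compose:
  "bounded_clinear a \<Longrightarrow> bounded_clinear b \<Longrightarrow> bounded_clinear (\<lambda>x. a (b x))"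
  by (auto simp: bounded_clinear_def clinear_iff bounded_linear_compose)

text \<open>A nearly optimal representation of \<open>u\<close> alone is inserted. The swap turns
  its terms into \<open>x k \<otimes>\<^sub>C module_act (b k) v\<close>, where
  \<open>onorm (b k)\<close> is at most \<open>onorm a * norm (\<xi> k)\<close>, and the
  \<open>PL\<close>-property of \<open>N\<close> takes this operator norm out.\<close>

lemma p_PL_norm_module_act_diamond_le:
  fixes u :: "('h::chilbert_space, 'e::complex_normed_vector) ctensor"
  assumes D: "cbilinear D" and norm_D: "\<And>\<xi> \<eta>. norm (D \<xi> \<eta>) = norm \<xi> * norm \<eta>"
    and N: "PL_space N" and a: "bounded_clinear a"
  shows "p_PL_norm N (module_act a (diamond D u v)) \<le> onorm a * max_PL_norm u * N v"
proof -
  have cN: "is_cnorm N" and actN: "\<And>b w. bounded_clinear b \<Longrightarrow> N (module_act b w) \<le> onorm b * N w"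
    using N by (simp_all add: PL_space_def)
  note N_nonneg = is_cnorm_nonneg[OF cN]
  have a': "clinear a" "bounded_linear a" using a by (simp_all add: bounded_clinear_def)
  define C where "C = onorm a * N v"
  have C: "0 \<le> C" unfolding C_def using onorm_pos_le[OF a'(2)] N_nonneg by simp
  have approx: "p_PL_norm N (module_act a (diamond D u v)) \<le> C * (max_PL_norm u + \<epsilon>)"
    if \<epsilon>: "0 < \<epsilon>" for \<epsilon>
  proof -
    obtain n :: nat and \<xi> x where u: "u = (\<Sum>k<n. \<xi> k \<otimes>\<^sub>C x k)"
      and less: "(\<Sum>k<n. norm (\<xi> k) * norm (x k)) < max_PL_norm u + \<epsilon>"
      unfolding max_PL_norm_def by (rule projective_norm_approx[OF norm_ge_zero norm_ge_zero \<epsilon>])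
    define b where "b k = (\<lambda>\<eta>. a (D (\<xi> k) \<eta>))" for k
    have d: "clinear (\<lambda>u. diamond D u v)"
      using cbilinear_diamond[OF D] unfolding cbilinear_def by blast
    have "tensor_swap (module_act a (diamond D u v)) = (\<Sum>k<n. x k \<otimes>\<^sub>C module_act (b k) v)"
      unfolding u clinear_sum[OF d] clinear_sum[OF clinear_module_act[OF a'(1)]]
        clinear_sum[OF clinear_tensor_swap] tensor_swap_module_act_diamond[OF D a'(1)] b_def ..
    then have "p_PL_norm N (module_act a (diamond D u v))
        \<le> (\<Sum>k<n. norm (x k) * N (module_act (b k) v))"
      unfolding p_PL_norm_def by (intro projective_norm_le norm_ge_zero N_nonneg)
    also have "\<dots> \<le> (\<Sum>k<n. C * (norm (\<xi> k) * norm (x k)))"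
    proof (rule sum_mono)
      fix k
      note Dk = bounded_clinear_partial[OF D norm_D, of "\<xi> k"]
      have "onorm (b k) \<le> onorm a * onorm (D (\<xi> k))"
        using onorm_compose[of a "D (\<xi> k)"] a'(2) Dk(1) unfolding b_def
        by (simp add: bounded_clinear_def comp_def)
      also have "\<dots> \<le> onorm a * norm (\<xi> k)"
        using Dk(2) onorm_pos_le[OF a'(2)] by (rule mult_left_mono)
      finally have on: "onorm (b k) \<le> onorm a * norm (\<xi> k)" .
      have "N (module_act (b k) v) \<le> onorm (b k) * N v"
        unfolding b_def by (rule actN[OF bounded_clinear_compose[OF a Dk(1)]])
      also have "\<dots> \<le> (onorm a * norm (\<xi> k)) * N v"
        using on N_nonneg by (rule mult_right_mono)
      finally have "norm (x k) * N (module_act (b k) v) \<le> norm (x k) * ((onorm a * norm (\<xi> k)) * N v)"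
        by (rule mult_left_mono) simp
      then show "norm (x k) * N (module_act (b k) v) \<le> C * (norm (\<xi> k) * norm (x k))"
        by (simp add: C_def algebra_simps)
    qed
    also have "\<dots> = C * (\<Sum>k<n. norm (\<xi> k) * norm (x k))" by (rule sum_distrib_left[symmetric])
    also have "\<dots> \<le> C * (max_PL_norm u + \<epsilon>)" using less_imp_le[OF less] C by (rule mult_left_mono)
    finally show ?thesis .
  qed
  have "p_PL_norm N (module_act a (diamond D u v)) \<le> C * max_PL_norm u"
  proof (rule field_le_epsilon)
    fix \<epsilon> :: real assume \<epsilon>: "0 < \<epsilon>"
    \<comment> \<open>Dividing by \<open>C + 1\<close> rather than by \<open>C\<close> covers the
      case \<open>C = 0\<close>.\<close>
    have "C * (\<epsilon> / (C + 1)) \<le> \<epsilon>" using C \<epsilon> by (simp add: divide_le_eq algebra_simps)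
    moreover have "p_PL_norm N (module_act a (diamond D u v)) \<le> C * (max_PL_norm u + \<epsilon> / (C + 1))"
      using C \<epsilon> by (intro approx) simp
    ultimately show "p_PL_norm N (module_act a (diamond D u v)) \<le> C * max_PL_norm u + \<epsilon>"
      by (simp only: distrib_left)
  qed
  then show ?thesis unfolding C_def by (simp only: mult_ac)
qed

lemma pl_norm_max_eq_p_PL_norm:
  fixes D :: "'h::chilbert_space \<Rightarrow> 'h \<Rightarrow> 'h" and e :: 'h
    and N :: "('h, 'f::complex_vector) ctensor \<Rightarrow> real"
    and U :: "('h, ('e::complex_normed_vector, 'f) ctensor) ctensor"
  assumes D: "cbilinear D" and norm_D: "\<And>\<xi> \<eta>. norm (D \<xi> \<eta>) = norm \<xi> * norm \<eta>"
    and e: "norm e = 1" and N: "PL_space N"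
  shows "pl_norm D max_PL_norm N U = p_PL_norm N U"
proof -
  have N_nonneg: "0 \<le> N v" for v using N by (simp add: PL_space_def is_cnorm_nonneg)
  have max_nonneg: "0 \<le> max_PL_norm u" for u :: "('h, 'e) ctensor"
    unfolding max_PL_norm_def by (intro projective_norm_nonneg norm_ge_zero)
  define R where "R = {\<Sum>k<n. onorm (a k) * max_PL_norm (u k) * N (v k) |(n::nat) a (u :: nat \<Rightarrow> ('h, 'e) ctensor) v.
      (\<forall>k<n. bounded_clinear (a k)) \<and> U = (\<Sum>k<n. module_act (a k) (diamond D (u k) (v k)))}"
  \<comment> \<open>\<open>D e\<close> is isometric because \<open>e\<close> is a unit
    vector.\<close>
  obtain a where a: "bounded_clinear a" "onorm a \<le> 1" "\<And>\<eta>. a (D e \<eta>) = \<eta>"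
    using isometry_left_inverse[of "D e"] D norm_D e by (auto simp: cbilinear_def)
  have ca: "clinear a" using a(1) by (simp add: bounded_clinear_def)
  have swap_elem: "tensor_swap (x \<otimes>\<^sub>C v) = module_act a (diamond D (e \<otimes>\<^sub>C x) v)"
    for x :: 'e and v :: "('h, 'f) ctensor"
  proof -
    \<comment> \<open>The action of the identity of H and the amplification of the identity of F
      unfold to the same \<open>tensor_lift\<close>.\<close>
    have "module_act (\<lambda>\<eta>. a (D e \<eta>)) v = amplification (\<lambda>x. x) v"
      by (simp add: a(3) module_act_def amplification_def)
    then have "x \<otimes>\<^sub>C v = tensor_swap (module_act a (diamond D (e \<otimes>\<^sub>C x) v))"
      by (simp add: tensor_swap_module_act_diamond[OF D ca] amplification_ident)
    then show ?thesis by (simp add: tensor_swap_swap)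
  qed
  have rep: "(\<Sum>k<n. onorm a * max_PL_norm (e \<otimes>\<^sub>C x k) * N (v k)) \<in> R"
    if "tensor_swap U = (\<Sum>k<n. x k \<otimes>\<^sub>C v k)" for n :: nat and x :: "nat \<Rightarrow> 'e" and v
  proof -
    have "U = tensor_swap (\<Sum>k<n. x k \<otimes>\<^sub>C v k)"
      using tensor_swap_swap[of U] that by simp
    also have "\<dots> = (\<Sum>k<n. module_act a (diamond D (e \<otimes>\<^sub>C x k) (v k)))"
      by (simp add: clinear_sum[OF clinear_tensor_swap] swap_elem)
    finally show ?thesis
      unfolding R_def using a(1) by (intro CollectI exI[of _ n] exI[of _ "\<lambda>_. a"] exI[of _ "\<lambda>k. e \<otimes>\<^sub>C x k"] exI[of _ v]) simp
  qed
  obtain n\<^sub>0 :: nat and x\<^sub>0 v\<^sub>0 where rep\<^sub>0: "tensor_swap U = (\<Sum>k<n\<^sub>0. x\<^sub>0 k \<otimes>\<^sub>C v\<^sub>0 k)"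
    by (rule ctensor_sum_obtain)
  have pl: "pl_norm D max_PL_norm N U = Inf R" by (simp add: pl_norm_def R_def)
  show ?thesis
    unfolding pl
  proof (rule order_antisym)
    have bdd: "bdd_below R"
      unfolding R_def
      by (rule bdd_belowI[of _ 0])
        (auto simp: bounded_clinear_def intro!: sum_nonneg mult_nonneg_nonneg onorm_pos_le
          max_nonneg N_nonneg)
    show "Inf R \<le> p_PL_norm N U"
      unfolding p_PL_norm_def projective_norm_def
    proof (rule cInf_greatest)
      show "{\<Sum>k<n. norm (x k) * N (v k) |(n::nat) x v. tensor_swap U = (\<Sum>k<n. x k \<otimes>\<^sub>C v k)} \<noteq> {}"
        using rep\<^sub>0 by blast
      fix z assume "z \<in> {\<Sum>k<n. norm (x k) * N (v k) |(n::nat) x v. tensor_swap U = (\<Sum>k<n. x k \<otimes>\<^sub>C v k)}"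
      then obtain n :: nat and x v where z: "z = (\<Sum>k<n. norm (x k) * N (v k))"
        and U: "tensor_swap U = (\<Sum>k<n. x k \<otimes>\<^sub>C v k)" by blast
      have "Inf R \<le> (\<Sum>k<n. onorm a * max_PL_norm (e \<otimes>\<^sub>C x k) * N (v k))"
        by (rule cInf_lower[OF rep[OF U] bdd])
      also have "\<dots> \<le> (\<Sum>k<n. norm (x k) * N (v k))"
      proof (rule sum_mono, rule mult_right_mono[OF _ N_nonneg])
        fix k
        have "max_PL_norm (e \<otimes>\<^sub>C x k) \<le> norm (x k)"
          unfolding max_PL_norm_def
          using projective_norm_elem_le[of norm norm e "x k"] e by simp
        then show "onorm a * max_PL_norm (e \<otimes>\<^sub>C x k) \<le> norm (x k)"
          using mult_mono[OF a(2), of "max_PL_norm (e \<otimes>\<^sub>C x k)" "norm (x k)"] max_nonneg by simp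
      qed
      finally show "Inf R \<le> z" by (simp add: z)
    qed
    show "p_PL_norm N U \<le> Inf R"
    proof (rule cInf_greatest)
      show "R \<noteq> {}" using rep[OF rep\<^sub>0] by blast
      fix z assume "z \<in> R"
      then obtain n :: nat and a u v where z: "z = (\<Sum>k<n. onorm (a k) * max_PL_norm (u k) * N (v k))"
        and a: "\<And>k. k < n \<Longrightarrow> bounded_clinear (a k)"
        and U: "U = (\<Sum>k<n. module_act (a k) (diamond D (u k) (v k)))" unfolding R_def by blast
      \<comment> \<open>Subadditivity reduces the estimate to a single term of the
        representation.\<close>
      have "p_PL_norm N U \<le> (\<Sum>k<n. p_PL_norm N (module_act (a k) (diamond D (u k) (v k))))"
        unfolding U p_PL_norm_def clinear_sum[OF clinear_tensor_swap]
        by (rule projective_norm_sum) (simp_all add: N_nonneg)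
      also have "\<dots> \<le> z"
        unfolding z by (intro sum_mono p_PL_norm_module_act_diamond_le D norm_D N a) simp
      finally show "p_PL_norm N U \<le> z" .
    qed
  qed
qed


section \<open>Uniqueness of the completion\<close>

text \<open>The slice map induced by \<open>cinner e\<close> sends
  \<open>e \<otimes>\<^sub>C x\<close> back to \<open>x\<close>, since
  \<open>cinner e e = 1\<close>.\<close>

lemma elem_tensor_eq_zero_iff:
  fixes e :: "'h::chilbert_space" and x :: "'e::complex_vector"
  assumes "norm e = 1"
  shows "e \<otimes>\<^sub>C x = 0 \<longleftrightarrow> x = 0"
proof
  have bil: "cbilinear (\<lambda>\<eta> (y::'e). cinner e \<eta> *\<^sub>C y)"
    by (simp add: cbilinear_def clinear_iff cinner_add_right cinner_scaleC_right scaleC_add_left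
        scaleC_add_right)
  assume "e \<otimes>\<^sub>C x = 0"
  then show "x = 0"
    using tensor_lift_elem[OF bil, of e x] tensor_lift_linear(1)[OF bil] assms
    by (simp add: cinner_self scaleC_one)
qed simp

text \<open>This encodes a linear combination of vectors as one sum of elementary tensors, so that
  norms on the tensor product can detect linear relations.\<close>

lemma sum_scaled_elem_tensor:
  fixes x :: "'a::complex_vector" and y :: "'i \<Rightarrow> 'b::complex_vector"
  shows "(\<Sum>i\<in>A. (c i *\<^sub>C x) \<otimes>\<^sub>C y i) = x \<otimes>\<^sub>C (\<Sum>i\<in>A. c i *\<^sub>C y i)"
proof -
  have "clinear (\<lambda>y::'b. x \<otimes>\<^sub>C y)" by (simp add: clinear_iff elem_tensor_simps)
  then show ?thesis by (simp add: clinear_sum[of "\<lambda>y. x \<otimes>\<^sub>C y"] elem_tensor_simps)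
qed

lemma is_cnorm_underlying_norm:
  fixes N :: "('h::chilbert_space, 'e::complex_vector) ctensor \<Rightarrow> real" and e :: 'h
  assumes N: "PL_space N" and e: "norm e = 1"
  shows "is_cnorm (underlying_norm N)"
  unfolding is_cnorm_def underlying_norm_eq[OF N e] elem_tensor_simps
proof (intro conjI allI impI)
  have cN: "is_cnorm N" using N by (simp add: PL_space_def)
  fix x y :: 'e and c
  show "N (e \<otimes>\<^sub>C x + e \<otimes>\<^sub>C y) \<le> N (e \<otimes>\<^sub>C x) + N (e \<otimes>\<^sub>C y)"
    and "N (c *\<^sub>C e \<otimes>\<^sub>C x) = cmod c * N (e \<otimes>\<^sub>C x)"
    using cN by (simp_all add: is_cnorm_def)
  assume "N (e \<otimes>\<^sub>C x) = 0"
  then have "e \<otimes>\<^sub>C x = 0" using cN by (simp add: is_cnorm_def)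
  then show "x = 0" by (simp add: elem_tensor_eq_zero_iff[OF e])
qed

lemma is_cnorm_eq_zero_iff: "is_cnorm N \<Longrightarrow> N u = 0 \<longleftrightarrow> u = 0"
  using is_cnorm_zero by (auto simp: is_cnorm_def)

lemma is_cnorm_minus: "is_cnorm N \<Longrightarrow> N (- u) = N u"
  unfolding is_cnorm_def by (metis scaleC_minus_one norm_minus_cancel norm_one mult_1)

lemma is_cnorm_convergent_Cauchy:
  assumes N: "is_cnorm N" and lim: "(\<lambda>n. N (s n - y)) \<longlonglongrightarrow> 0" and \<epsilon>: "0 < \<epsilon>"
  shows "\<exists>M::nat. \<forall>m\<ge>M. \<forall>n\<ge>M. N (s m - s n) < \<epsilon>"
proof -
  have "eventually (\<lambda>n. N (s n - y) < \<epsilon> / 2) sequentially"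
    using order_tendstoD(2)[OF lim, of "\<epsilon> / 2"] \<epsilon> by simp
  then obtain M where M: "\<And>n. n \<ge> M \<Longrightarrow> N (s n - y) < \<epsilon> / 2"
    by (auto simp: eventually_sequentially)
  have "N (s m - s n) < \<epsilon>" if "m \<ge> M" "n \<ge> M" for m n
  proof -
    have "N ((s m - y) + - (s n - y)) \<le> N (s m - y) + N (- (s n - y))"
      using N unfolding is_cnorm_def by blast
    then have "N (s m - s n) \<le> N (s m - y) + N (s n - y)"
      unfolding is_cnorm_minus[OF N] by simp
    then show ?thesis using M[OF that(1)] M[OF that(2)] by linarith
  qed
  then show ?thesis by blast
qed

text \<open>Both canonical maps preserve the underlying norm of \<open>M\<close>, so the images of
  \<open>s\<close> have the same mutual distances in both completions; a limit in one makes the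
  images Cauchy in the other, which is complete.\<close>

lemma PL_completion_transfer_limit:
  fixes e :: "'h::chilbert_space" and M :: "('h, 'e::complex_vector) ctensor \<Rightarrow> real"
  assumes e: "norm e = 1" and c1: "PL_completion M N\<^sub>1 j\<^sub>1" and c2: "PL_completion M N\<^sub>2 j\<^sub>2"
    and lim: "(\<lambda>n. underlying_norm N\<^sub>1 (j\<^sub>1 (s n) - y)) \<longlonglongrightarrow> 0"
  shows "\<exists>z. (\<lambda>n. underlying_norm N\<^sub>2 (j\<^sub>2 (s n) - z)) \<longlonglongrightarrow> 0"
proof -
  have dist: "underlying_norm N\<^sub>2 (j\<^sub>2 u - j\<^sub>2 v) = underlying_norm N\<^sub>1 (j\<^sub>1 u - j\<^sub>1 v)" for u v
    using c1 c2 unfolding PL_completion_def by (metis clinear_diff)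
  have "is_cnorm (underlying_norm N\<^sub>1)"
    using c1 e is_cnorm_underlying_norm by (auto simp: PL_completion_def)
  then have "\<forall>\<epsilon>>0. \<exists>K. \<forall>m\<ge>K. \<forall>n\<ge>K. underlying_norm N\<^sub>2 (j\<^sub>2 (s m) - j\<^sub>2 (s n)) < \<epsilon>"
    unfolding dist using is_cnorm_convergent_Cauchy[OF _ lim] by blast
  moreover have "PL_complete N\<^sub>2" using c2 by (simp add: PL_completion_def)
  ultimately show ?thesis unfolding PL_complete_def by (elim allE[of _ "\<lambda>n. j\<^sub>2 (s n)"] impE)
qed

lemma PL_completion_unique:
  fixes e :: "'h::chilbert_space" and M :: "('h, 'e::complex_vector) ctensor \<Rightarrow> real"
    and N\<^sub>1 :: "('h, 'g\<^sub>1::complex_vector) ctensor \<Rightarrow> real"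
    and N\<^sub>2 :: "('h, 'g\<^sub>2::complex_vector) ctensor \<Rightarrow> real"
  assumes e: "norm e = 1" and c1: "PL_completion M N\<^sub>1 j\<^sub>1" and c2: "PL_completion M N\<^sub>2 j\<^sub>2"
  obtains J where "L_isometric_isomorphism N\<^sub>1 N\<^sub>2 J"
    and "extension_by_continuity N\<^sub>1 N\<^sub>2 j\<^sub>1 j\<^sub>2 (\<lambda>t. t) J"
proof -
  define R where "R y z \<longleftrightarrow> (\<exists>s. (\<lambda>n. underlying_norm N\<^sub>1 (j\<^sub>1 (s n) - y)) \<longlonglongrightarrow> 0
      \<and> (\<lambda>n. underlying_norm N\<^sub>2 (j\<^sub>2 (s n) - z)) \<longlonglongrightarrow> 0)" for y z
  have P1: "PL_space N\<^sub>1" and P2: "PL_space N\<^sub>2"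
    using c1 c2 by (simp_all add: PL_completion_def)
  have cn1: "is_cnorm N\<^sub>1" and cn2: "is_cnorm N\<^sub>2" using P1 P2 by (simp_all add: PL_space_def)
  have "\<exists>z. R y z" for y
    using c1 PL_completion_transfer_limit[OF e c1 c2] unfolding R_def PL_completion_def by meson
  then obtain J where J: "R y (J y)" for y by metis
  have "\<exists>y. R y z" for z
    using c2 PL_completion_transfer_limit[OF e c2 c1] unfolding R_def PL_completion_def by meson
  then obtain K where K: "R (K z) z" for z by metis
  have R_isometric: "N\<^sub>1 (\<Sum>i<m. \<xi> i \<otimes>\<^sub>C x i) = N\<^sub>2 (\<Sum>i<m. \<xi> i \<otimes>\<^sub>C z i)"
    if R: "\<And>i. i < m \<Longrightarrow> R (x i) (z i)" for m :: nat and \<xi> x z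
  proof -
    obtain s where "\<And>i. i < m \<Longrightarrow> (\<lambda>n. underlying_norm N\<^sub>1 (j\<^sub>1 (s i n) - x i)) \<longlonglongrightarrow> 0"
      "\<And>i. i < m \<Longrightarrow> (\<lambda>n. underlying_norm N\<^sub>2 (j\<^sub>2 (s i n) - z i)) \<longlonglongrightarrow> 0"
      using R unfolding R_def by metis
    then have "(\<lambda>n. M (\<Sum>i<m. \<xi> i \<otimes>\<^sub>C s i n)) \<longlonglongrightarrow> N\<^sub>1 (\<Sum>i<m. \<xi> i \<otimes>\<^sub>C x i)"
      "(\<lambda>n. M (\<Sum>i<m. \<xi> i \<otimes>\<^sub>C s i n)) \<longlonglongrightarrow> N\<^sub>2 (\<Sum>i<m. \<xi> i \<otimes>\<^sub>C z i)"
      using c1 c2 unfolding PL_completion_def by blast+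
    then show ?thesis by (rule LIMSEQ_unique)
  qed
  \<comment> \<open>With \<open>c i *\<^sub>C e\<close> as Hilbert space vectors,
    \<open>R_isometric\<close> shows that \<open>R\<close> preserves and reflects linear relations.
    Its being single-valued, injective and linear are all instances.\<close>
  have zero_iff: "(\<Sum>i<m. c i *\<^sub>C x i) = 0 \<longleftrightarrow> (\<Sum>i<m. c i *\<^sub>C z i) = 0"
    if R: "\<And>i. i < m \<Longrightarrow> R (x i) (z i)" for m :: nat and c x z
  proof -
    have "N\<^sub>1 (e \<otimes>\<^sub>C (\<Sum>i<m. c i *\<^sub>C x i)) = N\<^sub>2 (e \<otimes>\<^sub>C (\<Sum>i<m. c i *\<^sub>C z i))"
      using R_isometric[of m x z "\<lambda>i. c i *\<^sub>C e", OF R] unfolding sum_scaled_elem_tensor .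
    then have "N\<^sub>1 (e \<otimes>\<^sub>C (\<Sum>i<m. c i *\<^sub>C x i)) = 0 \<longleftrightarrow> N\<^sub>2 (e \<otimes>\<^sub>C (\<Sum>i<m. c i *\<^sub>C z i)) = 0"
      by simp
    then show ?thesis
      unfolding is_cnorm_eq_zero_iff[OF cn1] is_cnorm_eq_zero_iff[OF cn2] elem_tensor_eq_zero_iff[OF e] .
  qed
  \<comment> \<open>The relation used has two terms, with coefficients 1 and -1.\<close>
  have R_unique: "y = y' \<longleftrightarrow> z = z'" if "R y z" "R y' z'" for y y' z z'
    using zero_iff[of 2 "\<lambda>i. if i = 0 then y else y'" "\<lambda>i. if i = 0 then z else z'"
        "\<lambda>i. if i = 0 then 1 else - 1"] that
    by (simp add: numeral_2_eq_2 scaleC_one scaleC_minus_one)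
  have JK: "J (K z) = z" for z using R_unique[OF J K] by blast
  have KJ: "K (J y) = y" for y using R_unique[OF K J] by blast
  have linJ: "clinear J"
    unfolding clinear_iff
  proof (intro conjI allI)
    fix x y c
    \<comment> \<open>The trivial relation between \<open>x\<close>, \<open>y\<close> and
      \<open>x + y\<close> is carried over to their images.\<close>
    have "J x + J y + - J (x + y) = 0"
      using zero_iff[of 3 "\<lambda>i. [x, y, x + y] ! i" "\<lambda>i. J ([x, y, x + y] ! i)" "\<lambda>i. [1, 1, - 1] ! i"] J
      by (simp add: numeral_3_eq_3 scaleC_one scaleC_minus_one)
    then show "J (x + y) = J x + J y" by (simp add: algebra_simps)
    have "c *\<^sub>C J x + - J (c *\<^sub>C x) = 0"
      using zero_iff[of 2 "\<lambda>i. [x, c *\<^sub>C x] ! i" "\<lambda>i. J ([x, c *\<^sub>C x] ! i)" "\<lambda>i. [c, - 1] ! i"] J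
      by (simp add: numeral_2_eq_2 scaleC_minus_one)
    then show "J (c *\<^sub>C x) = c *\<^sub>C J x" by simp
  qed
  have ampJ: "clinear (amplification J :: ('h, 'g\<^sub>1) ctensor \<Rightarrow> _)"
    by (rule clinear_amplification[OF linJ])
  have iso: "N\<^sub>2 (amplification J u) = N\<^sub>1 u" for u
  proof -
    obtain m :: nat and \<xi> x where u: "u = (\<Sum>i<m. \<xi> i \<otimes>\<^sub>C x i)" by (rule ctensor_sum_obtain)
    show ?thesis
      using R_isometric[of m x "\<lambda>i. J (x i)" \<xi>] J
      by (simp add: u clinear_sum[OF ampJ] amplification_elem[OF linJ])
  qed
  have "bij J" by (rule o_bij[of K]) (auto simp: JK KJ)
  moreover have "bij (amplification J :: ('h, 'g\<^sub>1) ctensor \<Rightarrow> _)"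
  proof (rule bijI)
    show "inj (amplification J :: ('h, 'g\<^sub>1) ctensor \<Rightarrow> _)"
    proof (rule injI)
      fix u v :: "('h, 'g\<^sub>1) ctensor"
      assume "amplification J u = amplification J v"
      then have "N\<^sub>1 (u - v) = 0"
        using iso[of "u - v"] is_cnorm_zero[OF cn2] by (simp add: clinear_diff[OF ampJ])
      then have "u - v = 0" using cn1 unfolding is_cnorm_def by blast
      then show "u = v" by simp
    qed
    have "\<exists>u. w = amplification J u" for w :: "('h, 'g\<^sub>2) ctensor"
    proof (induction w rule: ctensor_induct)
      case zero
      show ?case by (rule exI[of _ 0]) (simp add: clinear_zero[OF ampJ])
    next
      case (elem \<xi> z)
      show ?case by (rule exI[of _ "\<xi> \<otimes>\<^sub>C K z"]) (simp add: amplification_elem[OF linJ] JK)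
    next
      case (add v w)
      then show ?case by (metis clinear_add[OF ampJ])
    qed
    then show "surj (amplification J :: ('h, 'g\<^sub>1) ctensor \<Rightarrow> _)" by (auto simp: surj_def)
  qed
  ultimately have "L_isometric_isomorphism N\<^sub>1 N\<^sub>2 J"
    using linJ iso by (simp add: L_isometric_isomorphism_def L_isometric_def)
  moreover have "extension_by_continuity N\<^sub>1 N\<^sub>2 j\<^sub>1 j\<^sub>2 (\<lambda>t. t) J"
  proof -
    have "underlying_norm N\<^sub>1 0 = 0" "underlying_norm N\<^sub>2 0 = 0"
      using is_cnorm_zero is_cnorm_underlying_norm P1 P2 e by blast+
    \<comment> \<open>The constant sequence \<open>t\<close> witnesses the relation.\<close>
    then have "R (j\<^sub>1 t) (j\<^sub>2 t)" for t
      unfolding R_def by (intro exI[of _ "\<lambda>_. t"]) simp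
    then have "J (j\<^sub>1 t) = j\<^sub>2 t" for t using R_unique[OF J] by blast
    \<comment> \<open>Evaluating the isometric amplification at
      \<open>e \<otimes>\<^sub>C (x - y)\<close> shows that \<open>J\<close> preserves distances,
      hence is continuous.\<close>
    moreover have "underlying_norm N\<^sub>2 (J x - J y) = underlying_norm N\<^sub>1 (x - y)" for x y
      using iso[of "e \<otimes>\<^sub>C (x - y)"]
      by (simp add: underlying_norm_eq[OF P1 e] underlying_norm_eq[OF P2 e]
          amplification_elem[OF linJ] clinear_diff[OF linJ])
    ultimately show ?thesis by (simp add: extension_by_continuity_def)
  qed
  ultimately show ?thesis by (rule that)
qed


section \<open>The identity isomorphism for the given diamond operation, and its extension to the
  completions\<close>

theorem theorem5p1:
  fixes hten :: "'h::chilbert_space \<Rightarrow> 'h \<Rightarrow> 'k::chilbert_space"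
    and \<iota> :: "'k \<Rightarrow> 'h"
    and N :: "('h, 'f::complex_vector) ctensor \<Rightarrow> real"
  assumes separable: "\<exists>S :: 'h set. countable S \<and> closure S = UNIV"
    and infinite_dim: "\<nexists>B :: 'h set. finite B \<and> cspan B = UNIV"
    and hten: "hilbert_tensor_product hten"
    and \<iota>: "unitary \<iota>"
    and F: "PL_space N"
  shows "\<exists>I :: ('e::complex_normed_vector, 'f) ctensor \<Rightarrow> ('e, 'f) ctensor.
    L_isometric_isomorphism (pl_norm (\<lambda>\<xi> \<eta>. \<iota> (hten \<xi> \<eta>)) max_PL_norm N) (p_PL_norm N) I \<and>
    (\<forall>t. I t = t) \<and>
    (\<forall>(N\<^sub>1 :: ('h, 'g\<^sub>1::complex_vector) ctensor \<Rightarrow> real) j\<^sub>1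
      (N\<^sub>2 :: ('h, 'g\<^sub>2::complex_vector) ctensor \<Rightarrow> real) j\<^sub>2.
      PL_completion (pl_norm (\<lambda>\<xi> \<eta>. \<iota> (hten \<xi> \<eta>)) max_PL_norm N) N\<^sub>1 j\<^sub>1 \<and>
      PL_completion (p_PL_norm N) N\<^sub>2 j\<^sub>2 \<longrightarrow>
      (\<exists>J :: 'g\<^sub>1 \<Rightarrow> 'g\<^sub>2. L_isometric_isomorphism N\<^sub>1 N\<^sub>2 J \<and>
        extension_by_continuity N\<^sub>1 N\<^sub>2 j\<^sub>1 j\<^sub>2 I J))"
proof -
  define D where "D = (\<lambda>\<xi> \<eta>. \<iota> (hten \<xi> \<eta>))"
  obtain v :: 'h where "v \<noteq> 0"
  proof -
    \<comment> \<open>The empty set is finite and spans only 0, so H contains a nonzero vector;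
      normalised, it is the unit vector needed throughout.\<close>
    have "cspan {} \<noteq> (UNIV :: 'h set)" using infinite_dim by blast
    then show ?thesis using that by auto
  qed
  then have e: "norm (v /\<^sub>R norm v) = 1" by simp
  have D: "cbilinear D"
    using hten \<iota> by (simp add: D_def cbilinear_def clinear_iff hilbert_tensor_product_def unitary_def)
  have norm_D: "norm (D \<xi> \<eta>) = norm \<xi> * norm \<eta>" for \<xi> \<eta>
  proof -
    \<comment> \<open>The product formula for inner products of elementary tensors survives
      \<open>\<iota>\<close>, which is unitary.\<close>
    have "cinner (D \<xi> \<eta>) (D \<xi> \<eta>) = cinner \<xi> \<xi> * cinner \<eta> \<eta>"
      using hten \<iota> by (simp add: D_def hilbert_tensor_product_def unitary_def)
    then have "complex_of_real ((norm (D \<xi> \<eta>))\<^sup>2) = complex_of_real ((norm \<xi> * norm \<eta>)\<^sup>2)"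
      by (simp add: cinner_self power_mult_distrib)
    then have "(norm (D \<xi> \<eta>))\<^sup>2 = (norm \<xi> * norm \<eta>)\<^sup>2" by (simp only: of_real_eq_iff)
    then show ?thesis by (simp add: power2_eq_iff_nonneg)
  qed
  have eq: "(pl_norm D max_PL_norm N :: ('h, ('e, 'f) ctensor) ctensor \<Rightarrow> real) = p_PL_norm N"
    by (rule ext, rule pl_norm_max_eq_p_PL_norm[OF D norm_D e F])
  have "L_isometric_isomorphism (p_PL_norm N) (p_PL_norm N) (\<lambda>t :: ('e, 'f) ctensor. t)"
    by (simp add: L_isometric_isomorphism_def L_isometric_def clinear_iff amplification_ident
        bij_def inj_def surj_def)
  \<comment> \<open>By \<open>eq\<close> the two completions are completions of one and the same
    \<open>PL\<close>-space, so the corollary is an instance of uniqueness.\<close>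
  moreover have "\<exists>J. L_isometric_isomorphism N\<^sub>1 N\<^sub>2 J \<and> extension_by_continuity N\<^sub>1 N\<^sub>2 j\<^sub>1 j\<^sub>2 (\<lambda>t. t) J"
    if c: "PL_completion (p_PL_norm N) N\<^sub>1 j\<^sub>1 \<and> PL_completion (p_PL_norm N) N\<^sub>2 j\<^sub>2"
    for N\<^sub>1 :: "('h, 'g\<^sub>1) ctensor \<Rightarrow> real" and j\<^sub>1 :: "('e, 'f) ctensor \<Rightarrow> 'g\<^sub>1"
      and N\<^sub>2 :: "('h, 'g\<^sub>2) ctensor \<Rightarrow> real" and j\<^sub>2
  proof -
    obtain J where "L_isometric_isomorphism N\<^sub>1 N\<^sub>2 J" "extension_by_continuity N\<^sub>1 N\<^sub>2 j\<^sub>1 j\<^sub>2 (\<lambda>t. t) J"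
      by (rule PL_completion_unique[OF e conjunct1[OF c] conjunct2[OF c]])
    then show ?thesis by blast
  qed
  ultimately show ?thesis
    unfolding D_def[symmetric] eq by (intro exI[of _ "\<lambda>t. t"]) simp
qed

end
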